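(* Let $n\ge 1$ and let $h(\mathbf{u},\mathbf{v},\mathbf{w})$ be a real-valued function of three non-increasing sequences of $n$ real numbers such that $$h\bigl(\mathrm{s}^{\downarrow}(A+B),\mathrm{s}^{\downarrow}(A),\mathrm{s}^{\downarrow}(B)\bigr)\le 0$$ for all $n\times n$ Hermitian matrices $A$ and $B$. Suppose further that $h$ is a Schur-convex function (in the sense given in the context) of its first argument whenever the second and third arguments are kept fixed. Then $$h\bigl(\mathrm{AAE}^{\downarrow}(XY),\mathrm{AAE}^{\downarrow}(X),\mathrm{AAE}^{\downarrow}(Y)\bigr)\le 0$$ for all $n\times n$ unitary matrices $X$ and $Y$.
   Context: For an $n\times n$ matrix $A$, $\mathrm{s}^{\downarrow}(A)$ denotes the sequence of the $n$ singular values of $A$ arranged in descending order. For an $n\times n$ unitary matrix $X$, $\mathrm{AAE}^{\downarrow}(X)$ denotes the sequence of absolute values of the principal values of the arguments of the eigenvalues of $X$, arranged in descending order: if the eigenvalues of $X$ (counted with multiplicity) are $e^{ia_1},\dots,e^{ia_n}$ with $a_j\in(-\pi,\pi]$ for all $j$ and $|a_1|\ge|a_2|\ge\cdots\ge|a_n|$, then $\mathrm{AAE}^{\downarrow}(X)=(|a_1|,|a_2|,\dots,|a_n|)$. Given two non-increasing sequences of real numbers $\mathbf{u}=(u_1,\dots,u_n)$ and $\mathbf{u}'=(u_1',\dots,u_n')$, $\mathbf{u}$ is weakly sub-majorized by $\mathbf{u}'$ if $\sum_{j=1}^k u_j\le\sum_{j=1}^k u_j'$ for all $1\le k\le n$.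 A real-valued function $f(\mathbf{u})$ of non-increasing sequences is here called Schur-convex if $f(\mathbf{u})\le f(\mathbf{u}')$ whenever $\mathbf{u}$ is weakly sub-majorized by $\mathbf{u}'$. *)

theory Defs
  imports
    "HOL-Computational_Algebra.Fundamental_Theorem_Algebra"
    "Jordan_Normal_Form.Schur_Decomposition"
begin

definition hermitian_mat :: "complex mat \<Rightarrow> bool" where
  "hermitian_mat A \<longleftrightarrow> square_mat A \<and> mat_adjoint A = A"

definition unitary_mat :: "complex mat \<Rightarrow> bool" where
  "unitary_mat X \<longleftrightarrow> square_mat X \<and> inverts_mat X (mat_adjoint X) \<and> inverts_mat (mat_adjoint X) X"

text \<open>Eigenvalues are counted with algebraic multiplicity, as roots of the characteristic polynomial.\<close>

definition eigenvalue_mset :: "complex mat \<Rightarrow> complex multiset" where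
  "eigenvalue_mset A = proots (char_poly A)"

definition descending_list_of_multiset :: "real multiset \<Rightarrow> real list" where
  "descending_list_of_multiset M = rev (sorted_list_of_multiset M)"

text \<open>
  The eigenvalues of \<open>mat_adjoint A * A\<close> are nonnegative real numbers, given as elements of
  type \<^typ>\<open>complex\<close>; \<^const>\<open>Re\<close> only changes their type
  (see \<open>eigenvalue_adjoint_mult_self\<close> below).
\<close>

definition singular_values_desc :: "complex mat \<Rightarrow> real list" where
  "singular_values_desc A =
     descending_list_of_multiset
       (image_mset (\<lambda>z. sqrt (Re z)) (eigenvalue_mset (mat_adjoint A * A)))"

text \<open>\<^const>\<open>Arg\<close> is the principal argument, with values in the interval from \<open>- pi\<close> (excluded)
  to \<open>pi\<close> (included).\<close>

definition abs_args_desc :: "complex mat \<Rightarrow> real list" where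
  "abs_args_desc X =
     descending_list_of_multiset (image_mset (\<lambda>z. \<bar>Arg z\<bar>) (eigenvalue_mset X))"

definition noninc_seqs :: "nat \<Rightarrow> real list set" where
  "noninc_seqs n = {u. length u = n \<and> sorted_wrt (\<ge>) u}"

definition weakly_submajorized :: "real list \<Rightarrow> real list \<Rightarrow> bool" where
  "weakly_submajorized u u' \<longleftrightarrow>
     length u = length u' \<and> (\<forall>k\<in>{1..length u}. (\<Sum>j<k. u ! j) \<le> (\<Sum>j<k. u' ! j))"

text \<open>
  Monotonicity with respect to weak submajorization (not only majorization), restricted to
  non-increasing sequences of length \<open>n\<close>; values of \<open>f\<close> on other lists are irrelevant.
\<close>

definition schur_convex :: "nat \<Rightarrow> (real list \<Rightarrow> real) \<Rightarrow> bool" where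
  "schur_convex n f \<longleftrightarrow>
     (\<forall>u\<in>noninc_seqs n. \<forall>u'\<in>noninc_seqs n. weakly_submajorized u u' \<longrightarrow> f u \<le> f u')"

lemma mat_adjoint_carrier: "A \<in> carrier_mat m n \<Longrightarrow> mat_adjoint A \<in> carrier_mat n m"
  unfolding mat_adjoint_def by auto

lemma mat_adjoint_index:
  "A \<in> carrier_mat m n \<Longrightarrow> i < n \<Longrightarrow> j < m \<Longrightarrow> mat_adjoint A $$ (i, j) = cnj (A $$ (j, i))"
  unfolding mat_adjoint_def by (auto simp: mat_of_rows_def)

lemma descending_list_of_multiset_noninc:
  "descending_list_of_multiset M \<in> noninc_seqs (size M)"
proof -
  have "length (sorted_list_of_multiset M) = size M"
    by (metis mset_sorted_list_of_multiset size_mset)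
  then show ?thesis
    unfolding noninc_seqs_def descending_list_of_multiset_def
    by (simp add: sorted_wrt_rev)
qed

lemma size_eigenvalue_mset:
  "A \<in> carrier_mat n n \<Longrightarrow> size (eigenvalue_mset A) = n"
  unfolding eigenvalue_mset_def size_proots_complex using degree_monic_char_poly by blast

lemma singular_values_desc_noninc:
  assumes "A \<in> carrier_mat n n"
  shows "singular_values_desc A \<in> noninc_seqs n"
proof -
  have "mat_adjoint A * A \<in> carrier_mat n n"
    using assms mat_adjoint_carrier by (meson mult_carrier_mat)
  from size_eigenvalue_mset[OF this] show ?thesis
    unfolding singular_values_desc_def by (metis descending_list_of_multiset_noninc size_image_mset)
qed

lemma abs_args_desc_noninc:
  "X \<in> carrier_mat n n \<Longrightarrow> abs_args_desc X \<in> noninc_seqs n"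
  unfolding abs_args_desc_def
  by (metis descending_list_of_multiset_noninc size_image_mset size_eigenvalue_mset)

lemma abs_args_desc_eq:
  assumes "char_poly X = (\<Prod>a\<leftarrow>as. [:- cis a, 1:])"
    and "\<forall>a\<in>set as. - pi < a \<and> a \<le> pi"
    and "sorted_wrt (\<ge>) (map abs as)"
  shows "abs_args_desc X = map abs as"
proof -
  have "proots (\<Prod>a\<leftarrow>as. [:- cis a, 1:]) = mset (map cis as)"
    by (induction as) (simp_all add: proots_mult prod_list_zero_iff image_iff del: mult_pCons_left)
  then have ev: "eigenvalue_mset X = mset (map cis as)"
    unfolding eigenvalue_mset_def assms(1) .
  have "map (\<lambda>a. \<bar>Arg (cis a)\<bar>) as = map abs as"
    using assms(2) by (auto intro!: arg_cong[where f = abs] cis_Arg_unique simp: sgn_eq)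
  then have "image_mset (\<lambda>z. \<bar>Arg z\<bar>) (eigenvalue_mset X) = mset (map abs as)"
    unfolding ev by (metis (no_types, lifting) image_mset.compositionality list.map_comp mset_map comp_def map_eq_conv)
  moreover have "sort (map abs as) = rev (map abs as)"
    using assms(3) by (intro properties_for_sort) (simp_all add: sorted_wrt_rev rev_map[symmetric])
  ultimately show ?thesis
    unfolding abs_args_desc_def descending_list_of_multiset_def
    by (metis rev_rev_ident sorted_list_of_multiset_mset)
qed

lemma eigenvalue_adjoint_mult_self:
  assumes A: "A \<in> carrier_mat n n" and z: "z \<in># eigenvalue_mset (mat_adjoint A * A)"
  shows "z \<in> \<real>" and "0 \<le> Re z"
proof -
  let ?B = "mat_adjoint A"
  have B: "?B \<in> carrier_mat n n" and BA: "?B * A \<in> carrier_mat n n"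
    using mat_adjoint_carrier[OF A] A by auto
  have "char_poly (?B * A) \<noteq> 0" using degree_monic_char_poly[OF BA] by auto
  with z have "eigenvalue (?B * A) z"
    by (simp add: eigenvalue_root_char_poly[OF BA] eigenvalue_mset_def)
  then obtain v where v: "v \<in> carrier_vec n" "v \<noteq> 0\<^sub>v n" and ev: "(?B * A) *\<^sub>v v = z \<cdot>\<^sub>v v"
    unfolding eigenvalue_def eigenvector_def using B by auto
  have sq: "w \<bullet>c w = complex_of_real (\<Sum>i<n. (cmod (w $ i))\<^sup>2)" if "w \<in> carrier_vec n" for w
    using that unfolding scalar_prod_def
    by (simp add: complex_norm_square atLeast0LessThan del: of_real_power)
  define w where "w = A *\<^sub>v v"
  have w: "w \<in> carrier_vec n" unfolding w_def using A v by auto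
  have "w \<bullet>c w = (\<Sum>i<n. (\<Sum>j<n. A $$ (i,j) * v $ j) * cnj (w $ i))"
    unfolding scalar_prod_def using w v A
    by (simp add: w_def scalar_prod_def atLeast0LessThan)
  also have "\<dots> = (\<Sum>j<n. v $ j * cnj (\<Sum>i<n. cnj (A $$ (i,j)) * w $ i))"
    by (simp add: sum_distrib_left sum_distrib_right mult.assoc mult.left_commute, subst sum.swap, simp)
  also have "\<dots> = (\<Sum>j<n. v $ j * cnj ((?B *\<^sub>v w) $ j))"
    using w B by (intro sum.cong)
      (auto simp: scalar_prod_def mat_adjoint_index[OF A] atLeast0LessThan intro!: sum.cong)
  also have "?B *\<^sub>v w = z \<cdot>\<^sub>v v"
    using ev assoc_mult_mat_vec[OF B A v(1)] unfolding w_def by simp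
  also have "(\<Sum>j<n. v $ j * cnj ((z \<cdot>\<^sub>v v) $ j)) = cnj z * (v \<bullet>c v)"
    using v by (simp add: scalar_prod_def sum_distrib_left atLeast0LessThan mult.left_commute)
  finally have eq: "w \<bullet>c w = cnj z * (v \<bullet>c v)" .
  define p q where "p = (\<Sum>i<n. (cmod (w $ i))\<^sup>2)" and "q = (\<Sum>i<n. (cmod (v $ i))\<^sup>2)"
  have pq: "complex_of_real p = cnj z * complex_of_real q"
    using eq unfolding sq[OF w] sq[OF v(1)] p_def q_def .
  have "v \<bullet>c v \<noteq> 0" using v by simp
  then have "q \<noteq> 0" unfolding sq[OF v(1)] q_def by (metis of_real_0)
  moreover have "0 \<le> p" "0 \<le> q" unfolding p_def q_def by (auto intro: sum_nonneg)
  ultimately have "cnj z = complex_of_real (p / q)" "0 \<le> p / q"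
    using pq by (auto simp: field_simps)
  then have "z = complex_of_real (p / q)" by (metis complex_cnj_cnj complex_cnj_complex_of_real)
  then show "z \<in> \<real>" "0 \<le> Re z" using \<open>0 \<le> p / q\<close> by auto
qed

end

theory Submission
  imports Defs
begin

text \<open>
  Write \<open>X = exp (\<i>A)\<close> and \<open>Y = exp (\<i>B)\<close> with principal logarithms, so that the singular values
  of \<open>A\<close> and \<open>B\<close> are the absolute arguments of \<open>X\<close> and \<open>Y\<close>. The curve
  \<open>V t = exp (\<i>tA) * exp (\<i>tB)\<close> runs from \<open>1\<close> to \<open>X * Y\<close>, and its velocity
  \<open>exp (\<i>tA) * \<i>(A + B) * exp (\<i>tB)\<close> has the same singular values as \<open>A + B\<close> at all times.
  By first-order perturbation of eigenvalues and Ky Fan's maximum principle, the sum of the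
  \<open>k\<close> largest absolute arguments of \<open>V t\<close> therefore grows at a rate of at most the sum of the
  \<open>k\<close> largest singular values of \<open>A + B\<close>. Integrating over the unit interval shows that the
  absolute arguments of \<open>X * Y\<close> are weakly submajorized by the singular values of \<open>A + B\<close>.
  Differentiability of the eigenvalues is never needed: it is enough to know their difference
  quotients along subsequences on which the eigenbases converge.
\<close>

section \<open>Sums of the largest elements of a multiset\<close>

text \<open>The Ky Fan functional of order \<open>k\<close>: weak submajorization compares exactly
  these sums. Indexing is meaningful only for \<open>k \<le> size M\<close>, which every later use
  ensures.\<close>

definition ksum :: "nat \<Rightarrow> real multiset \<Rightarrow> real" where
  "ksum k M = (\<Sum>j<k. descending_list_of_multiset M ! j)"

text \<open>Sorting is realised by a permutation of the index set, so that sums over positions of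
  the sorted list can be compared with sums over the original indices.\<close>

lemma descending_list_enumeration:
  fixes f :: "nat \<Rightarrow> real" and n :: nat
  defines "s \<equiv> descending_list_of_multiset (image_mset f (mset_set {..<n}))"
  obtains p where "p permutes {..<n}" "\<And>j. j < n \<Longrightarrow> s ! j = f (p j)"
    "\<And>i j. i \<le> j \<Longrightarrow> j < n \<Longrightarrow> s ! j \<le> s ! i"
proof -
  have ms: "mset s = mset (map f [0..<n])"
    by (simp add: s_def descending_list_of_multiset_def lessThan_atLeast0)
  obtain p where p: "p permutes {..<length (map f [0..<n])}" "permute_list p (map f [0..<n]) = s"
    using mset_eq_permutation[OF ms] by blast
  have s: "length s = n" "sorted_wrt (\<ge>) s"
    using descending_list_of_multiset_noninc[of "image_mset f (mset_set {..<n})"]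
    by (simp_all add: s_def noninc_seqs_def)
  show thesis
  proof
    show "p permutes {..<n}" using p(1) by simp
    show "s ! j = f (p j)" if "j < n" for j
    proof -
      have "p j < n" using that p(1) permutes_in_image[of p "{..<n}" j] by simp
      moreover have "s ! j = map f [0..<n] ! p j"
        using p that by (metis permute_list_nth length_map length_upt minus_nat.diff_0)
      ultimately show ?thesis by simp
    qed
    show "s ! j \<le> s ! i" if "i \<le> j" "j < n" for i j
      using s that sorted_wrt_nth_less[OF s(2), of i j] by (cases "i = j") auto
  qed
qed

text \<open>Moving weight from small entries to large ones increases the sum, and the extreme
  position puts weight 1 on the \<open>k\<close> largest. The proof compares with the threshold
  \<open>t\<close>, the \<open>k\<close>-th largest entry: both weightings have total
  \<open>k\<close>, so subtracting \<open>t\<close> from all entries does not change their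
  difference.\<close>

lemma weighted_sum_le_ksum:
  fixes f c :: "nat \<Rightarrow> real"
  assumes c: "\<And>i. i < n \<Longrightarrow> 0 \<le> c i" "\<And>i. i < n \<Longrightarrow> c i \<le> 1"
    and sum_c: "(\<Sum>i<n. c i) = real k" and "k \<le> n"
  shows "(\<Sum>i<n. f i * c i) \<le> ksum k (image_mset f (mset_set {..<n}))"
proof -
  define s where "s = descending_list_of_multiset (image_mset f (mset_set {..<n}))"
  obtain p where p: "p permutes {..<n}" and sp: "\<And>j. j < n \<Longrightarrow> s ! j = f (p j)"
    and mono: "\<And>i j. i \<le> j \<Longrightarrow> j < n \<Longrightarrow> s ! j \<le> s ! i"
    using descending_list_enumeration[of n f] unfolding s_def by blast
  have pn: "p j < n" if "j < n" for j using that permutes_in_image[OF p, of j] by simp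
  \<comment> \<open>For \<open>k = 0\<close> truncated subtraction makes \<open>t\<close> the
    largest entry; this is harmless, since then only the case \<open>False\<close> below
    occurs.\<close>
  define t where "t = s ! (k - 1)"
  have "(s ! j - t) * (c (p j) - of_bool (j < k)) \<le> 0" if j: "j < n" for j
  proof (cases "j < k")
    case True
    then have "t \<le> s ! j" unfolding t_def using \<open>k \<le> n\<close> by (intro mono) auto
    then show ?thesis using True c(2)[OF pn[OF j]] by (auto intro!: mult_nonneg_nonpos)
  next
    case False
    then have "s ! j \<le> t" unfolding t_def using j by (intro mono) auto
    then show ?thesis using False c(1)[OF pn[OF j]] by (auto intro!: mult_nonpos_nonneg)
  qed
  then have "(\<Sum>j<n. (s ! j - t) * (c (p j) - of_bool (j < k))) \<le> 0"
    by (intro sum_nonpos) auto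
  also have "(\<Sum>j<n. (s ! j - t) * (c (p j) - of_bool (j < k)))
      = (\<Sum>j<n. s ! j * c (p j)) - (\<Sum>j<n. s ! j * of_bool (j < k))
        - t * ((\<Sum>j<n. c (p j)) - (\<Sum>j<n. of_bool (j < k)))"
    by (simp add: algebra_simps sum.distrib sum_subtractf sum_distrib_left)
  also have "(\<Sum>j<n. c (p j)) = real k"
    using sum.permute[OF p, of c] sum_c by simp
  also have "(\<Sum>j<n. of_bool (j < k)) = real k"
  proof -
    have "{..<n} \<inter> {j. j < k} = {..<k}" using \<open>k \<le> n\<close> by auto
    then show ?thesis by simp
  qed
  also have "(\<Sum>j<n. s ! j * of_bool (j < k)) = ksum k (image_mset f (mset_set {..<n}))"
  proof -
    have "(\<Sum>j<n. s ! j * of_bool (j < k)) = (\<Sum>j<k. s ! j)"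
      using \<open>k \<le> n\<close> by (intro sum.mono_neutral_cong_right) auto
    then show ?thesis by (simp add: ksum_def s_def)
  qed
  also have "(\<Sum>j<n. s ! j * c (p j)) = (\<Sum>i<n. f i * c i)"
    using sum.permute[OF p, of "\<lambda>i. f i * c i"] sp by simp
  finally show ?thesis by simp
qed

lemma sum_le_ksum:
  fixes f :: "nat \<Rightarrow> real"
  assumes "S \<subseteq> {..<n}"
  shows "sum f S \<le> ksum (card S) (image_mset f (mset_set {..<n}))"
proof -
  have S: "{..<n} \<inter> S = S" using assms by auto
  have "card S \<le> n" using card_mono[OF finite_lessThan assms] by simp
  have "sum f S = (\<Sum>i<n. f i * of_bool (i \<in> S))"
    using assms by (intro sum.mono_neutral_cong_left) auto
  also have "\<dots> \<le> ksum (card S) (image_mset f (mset_set {..<n}))"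
  proof (rule weighted_sum_le_ksum)
    show "(\<Sum>i<n. of_bool (i \<in> S)) = real (card S)"
      by (simp add: S)
  qed (use \<open>card S \<le> n\<close> in simp_all)
  finally show ?thesis .
qed

text \<open>Together with \<open>sum_le_ksum\<close> this makes \<open>ksum\<close> a maximum over
  index sets of size \<open>k\<close>; a maximising set is the image of the first \<open>k\<close>
  positions under the sorting permutation.\<close>

lemma ksum_attained:
  fixes f :: "nat \<Rightarrow> real"
  assumes "k \<le> n"
  obtains S where "S \<subseteq> {..<n}" "card S = k" "ksum k (image_mset f (mset_set {..<n})) = sum f S"
proof -
  obtain p where p: "p permutes {..<n}"
    and sp: "\<And>j. j < n \<Longrightarrow> descending_list_of_multiset (image_mset f (mset_set {..<n})) ! j = f (p j)"
    by (rule descending_list_enumeration[of n f]) blast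
  have inj: "inj_on p {..<k}" using permutes_inj_on[OF p] .
  show thesis
  proof
    show "p ` {..<k} \<subseteq> {..<n}" using assms permutes_in_image[OF p] by force
    show "card (p ` {..<k}) = k" using card_image[OF inj] by simp
    show "ksum k (image_mset f (mset_set {..<n})) = sum f (p ` {..<k})"
      using assms sp by (simp add: ksum_def sum.reindex[OF inj])
  qed
qed

section \<open>The spectral theorem for normal matrices\<close>

lemma mat_adjoint_mult:
  fixes A B :: "complex mat"
  assumes A: "A \<in> carrier_mat n m" and B: "B \<in> carrier_mat m l"
  shows "mat_adjoint (A * B) = mat_adjoint B * mat_adjoint A"
proof (rule eq_matI)
  have AB: "A * B \<in> carrier_mat n l" using A B by simp
  note carr = mat_adjoint_carrier[OF A] mat_adjoint_carrier[OF B] mat_adjoint_carrier[OF AB]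
  show "dim_row (mat_adjoint (A * B)) = dim_row (mat_adjoint B * mat_adjoint A)"
    "dim_col (mat_adjoint (A * B)) = dim_col (mat_adjoint B * mat_adjoint A)"
    using carr by auto
  fix i j assume "i < dim_row (mat_adjoint B * mat_adjoint A)" "j < dim_col (mat_adjoint B * mat_adjoint A)"
  then have ij: "i < l" "j < n" using carr by auto
  show "mat_adjoint (A * B) $$ (i, j) = (mat_adjoint B * mat_adjoint A) $$ (i, j)"
    using ij A B carr
    by (simp add: mat_adjoint_index[OF AB] scalar_prod_def mat_adjoint_index[OF A]
        mat_adjoint_index[OF B] mult.commute)
qed

lemma mat_adjoint_adjoint:
  fixes A :: "complex mat"
  assumes A: "A \<in> carrier_mat n m"
  shows "mat_adjoint (mat_adjoint A) = A"
  using A mat_adjoint_carrier[OF A] mat_adjoint_carrier[OF mat_adjoint_carrier[OF A]]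
  by (intro eq_matI) (auto simp: mat_adjoint_index[OF mat_adjoint_carrier[OF A]] mat_adjoint_index[OF A])

lemma mat_adjoint_add:
  fixes A B :: "complex mat"
  assumes A: "A \<in> carrier_mat n m" and B: "B \<in> carrier_mat n m"
  shows "mat_adjoint (A + B) = mat_adjoint A + mat_adjoint B"
proof -
  have AB: "A + B \<in> carrier_mat n m" using A B by simp
  show ?thesis
    using A B mat_adjoint_carrier[OF A] mat_adjoint_carrier[OF B] mat_adjoint_carrier[OF AB]
    by (intro eq_matI) (auto simp: mat_adjoint_index[OF A] mat_adjoint_index[OF B] mat_adjoint_index[OF AB])
qed

lemma mat_adjoint_diag: "mat_adjoint (mat_diag n d) = mat_diag n (\<lambda>i. cnj (d i))"
proof (rule eq_matI)
  note carr = mat_adjoint_carrier[OF mat_diag_dim[of n d]]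
  show "dim_row (mat_adjoint (mat_diag n d)) = dim_row (mat_diag n (\<lambda>i. cnj (d i)))"
    "dim_col (mat_adjoint (mat_diag n d)) = dim_col (mat_diag n (\<lambda>i. cnj (d i)))"
    using carr by (simp_all add: carrier_matD[OF mat_diag_dim])
  fix i j assume "i < dim_row (mat_diag n (\<lambda>i. cnj (d i)))" "j < dim_col (mat_diag n (\<lambda>i. cnj (d i)))"
  then have ij: "i < n" "j < n" by (simp_all add: carrier_matD[OF mat_diag_dim])
  show "mat_adjoint (mat_diag n d) $$ (i, j) = mat_diag n (\<lambda>i. cnj (d i)) $$ (i, j)"
    using ij by (subst mat_adjoint_index[OF mat_diag_dim ij]) (auto simp: mat_diag_def)
qed

lemma index_mult_mat_sum:
  assumes "A \<in> carrier_mat n m" "B \<in> carrier_mat m l" "i < n" "j < l"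
  shows "(A * B) $$ (i, j) = (\<Sum>k<m. A $$ (i, k) * B $$ (k, j))"
  using assms by (simp add: scalar_prod_def atLeast0LessThan)

lemma unitary_matD:
  assumes "unitary_mat P" "P \<in> carrier_mat n n"
  shows "P * mat_adjoint P = 1\<^sub>m n" "mat_adjoint P * P = 1\<^sub>m n"
  using assms mat_adjoint_carrier[OF assms(2)] by (auto simp: unitary_mat_def inverts_mat_def)

lemma unitary_matI:
  assumes P: "P \<in> carrier_mat n n" and "mat_adjoint P * P = 1\<^sub>m n"
  shows "unitary_mat P"
  using assms mat_adjoint_carrier[OF P] mat_mult_left_right_inverse[OF mat_adjoint_carrier[OF P] P]
  by (auto simp: unitary_mat_def inverts_mat_def)

lemma unitary_mat_adjoint:
  assumes "unitary_mat P" "P \<in> carrier_mat n n"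
  shows "unitary_mat (mat_adjoint P)"
  using unitary_matD[OF assms] mat_adjoint_carrier[OF assms(2)] mat_adjoint_adjoint[OF assms(2)]
  by (intro unitary_matI[of _ n]) auto

lemma unitary_mat_mult:
  assumes P: "unitary_mat P" "P \<in> carrier_mat n n" and Q: "unitary_mat Q" "Q \<in> carrier_mat n n"
  shows "unitary_mat (P * Q)"
proof (rule unitary_matI[of _ n])
  note carr = P(2) Q(2) mat_adjoint_carrier[OF P(2)] mat_adjoint_carrier[OF Q(2)]
  show "P * Q \<in> carrier_mat n n" using carr by simp
  have "mat_adjoint (P * Q) * (P * Q) = mat_adjoint Q * (mat_adjoint P * (P * Q))"
    using carr by (simp add: mat_adjoint_mult[OF P(2) Q(2)] assoc_mult_mat[of _ n n _ n _ n] mult_carrier_mat[of _ n n _ n])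
  also have "mat_adjoint P * (P * Q) = mat_adjoint P * P * Q" using carr by simp
  also have "\<dots> = Q" using carr unitary_matD[OF P] by simp
  finally show "mat_adjoint (P * Q) * (P * Q) = 1\<^sub>m n" using unitary_matD[OF Q] by simp
qed

lemma unitary_cancel:
  assumes P: "unitary_mat P" "P \<in> carrier_mat n n" and B: "B \<in> carrier_mat n m"
  shows "P * (mat_adjoint P * B) = B" "mat_adjoint P * (P * B) = B"
  using assoc_mult_mat[OF P(2) mat_adjoint_carrier[OF P(2)] B]
    assoc_mult_mat[OF mat_adjoint_carrier[OF P(2)] P(2) B] unitary_matD[OF P] B by simp_all

text \<open>Complete \<open>v\<close> to a basis, apply Gram-Schmidt, which leaves the first vector
  alone, and normalise the columns; \<open>c\<close> is the reciprocal of the norm of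
  \<open>v\<close>.\<close>

lemma unitary_completion:
  fixes v :: "complex vec"
  assumes v: "v \<in> carrier_vec n" "v \<noteq> 0\<^sub>v n"
  obtains W c where "W \<in> carrier_mat n n" "unitary_mat W" "col W 0 = c \<cdot>\<^sub>v v"
proof -
  interpret cof_vec_space n "TYPE(complex)" .
  define b where "b = basis_completion v"
  define ws where "ws = gram_schmidt n b"
  note bc = basis_completion[OF v, folded b_def]
  have n: "n \<noteq> 0" using v by auto
  from gram_schmidt_result[OF bc(2) bc(4) bc(5) ws_def] bc(6)
  have ws: "corthogonal ws" "set ws \<subseteq> carrier_vec n" "length ws = n" by auto
  from bc(6,7) n obtain vs where "b = v # vs" by (cases b) auto
  then have "hd ws = v" using gram_schmidt_hd[OF v(1), of vs] by (simp add: ws_def)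
  then have ws0: "ws ! 0 = v" using ws(3) n by (cases ws) auto
  \<comment> \<open>Gram-Schmidt yields orthogonal vectors that are not yet normalised;
    \<open>r j\<close> is the norm of the \<open>j\<close>-th one.\<close>
  define r where "r j = sqrt (\<Sum>i<n. (cmod (ws ! j $ i))\<^sup>2)" for j
  have sq: "w \<bullet>c w = complex_of_real (\<Sum>i<n. (cmod (w $ i))\<^sup>2)" if "w \<in> carrier_vec n" for w
    using that unfolding scalar_prod_def
    by (simp add: complex_norm_square atLeast0LessThan del: of_real_power)
  have wsc: "ws ! j \<in> carrier_vec n" if "j < n" for j using ws that by auto
  have r: "ws ! j \<bullet>c ws ! j = complex_of_real (r j * r j)"
    if "j < n" for j using sq[OF wsc[OF that]] by (simp add: r_def sum_nonneg)
  have r0: "r j \<noteq> 0" if "j < n" for j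
    using corthogonalD[OF ws(1), of j j] r[OF that] ws(3) that by auto
  define W where "W = mat n n (\<lambda>(i, j). ws ! j $ i / complex_of_real (r j))"
  have W: "W \<in> carrier_mat n n" by (simp add: W_def)
  have "mat_adjoint W * W = 1\<^sub>m n"
  proof (rule eq_matI)
    show "dim_row (mat_adjoint W * W) = dim_row (1\<^sub>m n :: complex mat)"
      "dim_col (mat_adjoint W * W) = dim_col (1\<^sub>m n :: complex mat)"
      using W mat_adjoint_carrier[OF W] by auto
    fix i j assume "i < dim_row (1\<^sub>m n :: complex mat)" "j < dim_col (1\<^sub>m n :: complex mat)"
    then have ij: "i < n" "j < n" by auto
    have "(mat_adjoint W * W) $$ (i, j) = (\<Sum>k<n. cnj (W $$ (k, i)) * W $$ (k, j))"
      using ij W by (simp add: index_mult_mat_sum[OF mat_adjoint_carrier[OF W] W]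
          mat_adjoint_index[OF W])
    also have "\<dots> = (\<Sum>k<n. ws ! j $ k * cnj (ws ! i $ k)) / (complex_of_real (r i) * complex_of_real (r j))"
      using ij by (simp add: W_def sum_divide_distrib mult.commute)
    also have "(\<Sum>k<n. ws ! j $ k * cnj (ws ! i $ k)) = ws ! j \<bullet>c ws ! i"
      using wsc[OF ij(1)] by (simp add: scalar_prod_def atLeast0LessThan)
    finally show "(mat_adjoint W * W) $$ (i, j) = 1\<^sub>m n $$ (i, j)"
      using corthogonalD[OF ws(1), of j i] r[OF ij(1)] r0[OF ij(1)] ws(3) ij by auto
  qed
  then have "unitary_mat W" by (rule unitary_matI[OF W])
  moreover have "col W 0 = (1 / complex_of_real (r 0)) \<cdot>\<^sub>v v"
    using n v(1) by (intro eq_vecI) (auto simp: W_def ws0)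
  ultimately show thesis using W that by blast
qed

text \<open>For unitary \<open>P\<close> the columns of \<open>P\<close> form an orthonormal
  eigenbasis with eigenvalues \<open>d\<close>. Keeping \<open>d\<close> as a function makes
  adjoints, products and exponentials pointwise operations on \<open>d\<close>; only its values
  below \<open>n\<close> matter.\<close>

definition spectral_mat :: "nat \<Rightarrow> complex mat \<Rightarrow> (nat \<Rightarrow> complex) \<Rightarrow> complex mat" where
  "spectral_mat n P d = P * mat_diag n d * mat_adjoint P"

lemma spectral_mat_carrier:
  assumes "P \<in> carrier_mat n n"
  shows "spectral_mat n P d \<in> carrier_mat n n"
  unfolding spectral_mat_def
  by (rule mult_carrier_mat[OF mult_carrier_mat[OF assms mat_diag_dim] mat_adjoint_carrier[OF assms]])

lemma index_spectral_mat:
  assumes "P \<in> carrier_mat n n" "i < n" "j < n"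
  shows "spectral_mat n P d $$ (i, j) = (\<Sum>l<n. P $$ (i, l) * d l * cnj (P $$ (j, l)))"
  using assms
    index_mult_mat_sum[OF mult_carrier_mat[OF assms(1) mat_diag_dim] mat_adjoint_carrier[OF assms(1)] assms(2,3)]
  by (simp add: spectral_mat_def mat_diag_mult_right[OF assms(1)] mat_adjoint_index[OF assms(1)])

definition normal_mat :: "complex mat \<Rightarrow> bool" where
  "normal_mat A \<longleftrightarrow> A * mat_adjoint A = mat_adjoint A * A"

text \<open>For \<open>i = j\<close> this says that row \<open>i\<close> and column \<open>i\<close>
  of a normal matrix have the same norm, which drives the deflation below.\<close>

lemma index_normal_mat:
  assumes "normal_mat A" "A \<in> carrier_mat n n" "i < n" "j < n"
  shows "(\<Sum>k<n. A $$ (i, k) * cnj (A $$ (j, k))) = (\<Sum>k<n. cnj (A $$ (k, i)) * A $$ (k, j))"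
proof -
  have "(A * mat_adjoint A) $$ (i, j) = (mat_adjoint A * A) $$ (i, j)"
    using assms(1) by (simp add: normal_mat_def)
  then show ?thesis
    using assms(2-)
    by (simp add: index_mult_mat_sum[OF _ mat_adjoint_carrier] index_mult_mat_sum[OF mat_adjoint_carrier]
        mat_adjoint_index[OF assms(2)])
qed

lemma normal_mat_unitary_conj:
  assumes A: "normal_mat A" "A \<in> carrier_mat n n" and W: "unitary_mat W" "W \<in> carrier_mat n n"
  shows "normal_mat (mat_adjoint W * A * W)"
proof -
  note aW = mat_adjoint_carrier[OF W(2)] and aA = mat_adjoint_carrier[OF A(2)]
  have adj: "mat_adjoint (mat_adjoint W * A * W) = mat_adjoint W * mat_adjoint A * W"
    using A W aW aA mat_adjoint_mult[of "mat_adjoint W * A" n n W n] mat_adjoint_mult[OF aW A(2)]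
      mat_adjoint_adjoint[OF W(2)] by simp
  have *: "(mat_adjoint W * B * W) * (mat_adjoint W * C * W) = mat_adjoint W * (B * C) * W"
    if B: "B \<in> carrier_mat n n" and C: "C \<in> carrier_mat n n" for B C
  proof -
    have "(mat_adjoint W * B * W) * (mat_adjoint W * C * W) = mat_adjoint W * B * (W * (mat_adjoint W * (C * W)))"
      using B C W aW by (simp add: assoc_mult_mat[of _ n n _ n _ n] mult_carrier_mat[of _ n n _ n])
    also have "W * (mat_adjoint W * (C * W)) = C * W"
      using B C W by (intro unitary_cancel(1)[OF W]) auto
    finally show ?thesis using B C W aW by (simp add: assoc_mult_mat[of _ n n _ n _ n] mult_carrier_mat[of _ n n _ n])
  qed
  show ?thesis
    using A(1) *[OF A(2) aA] *[OF aA A(2)] unfolding normal_mat_def adj by simp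
qed

text \<open>Deflation: in an orthonormal basis starting with an eigenvector, the first column
  vanishes below the diagonal. Normality then clears the first row as well, and the remaining block
  is again normal, so induction applies.\<close>

theorem normal_mat_diagonalizable:
  assumes "normal_mat A" "A \<in> carrier_mat n n"
  obtains P d where "P \<in> carrier_mat n n" "unitary_mat P" "A = spectral_mat n P d"
proof -
  have "\<exists>P d. P \<in> carrier_mat n n \<and> unitary_mat P \<and> A = spectral_mat n P d"
    using assms
  proof (induction n arbitrary: A)
    case 0
    have a: "mat_adjoint (1\<^sub>m 0) \<in> carrier_mat 0 0" by (rule mat_adjoint_carrier) simp
    have "unitary_mat (1\<^sub>m 0)" by (rule unitary_matI[of _ 0], simp, rule eq_matI) (use a in auto)
    moreover have "A = spectral_mat 0 (1\<^sub>m 0) (\<lambda>_. 0)"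
      unfolding spectral_mat_def using 0 a by (intro eq_matI) auto
    ultimately show ?case by (intro exI[of _ "1\<^sub>m 0"] exI[of _ "\<lambda>_. 0"]) auto
  next
    case (Suc m)
    let ?n = "Suc m"
    note A = Suc.prems
    obtain as where as: "char_poly A = (\<Prod>a\<leftarrow>as. [:- a, 1:])" "length as = ?n"
      using char_poly_factorized[OF A(2)] by blast
    then obtain e as' where "as = e # as'" by (cases as) auto
    then have "eigenvalue A e" unfolding eigenvalue_root_char_poly[OF A(2)] as(1) by simp
    then obtain v where v: "v \<in> carrier_vec ?n" "v \<noteq> 0\<^sub>v ?n" "A *\<^sub>v v = e \<cdot>\<^sub>v v"
      unfolding eigenvalue_def eigenvector_def using A(2) by auto
    obtain W c where W: "W \<in> carrier_mat ?n ?n" "unitary_mat W" "col W 0 = c \<cdot>\<^sub>v v"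
      using unitary_completion[OF v(1,2)] .
    note aW = mat_adjoint_carrier[OF W(1)]
    define A' where "A' = mat_adjoint W * A * W"
    have A': "A' \<in> carrier_mat ?n ?n" unfolding A'_def using A W aW by auto
    have normal: "normal_mat A'" unfolding A'_def by (rule normal_mat_unitary_conj[OF A W(2,1)])
    have "col A' 0 = mat_adjoint W *\<^sub>v (A *\<^sub>v col W 0)"
      unfolding A'_def assoc_mult_mat[OF aW A(2) W(1)]
        col_mult2[OF aW mult_carrier_mat[OF A(2) W(1)] zero_less_Suc]
        col_mult2[OF A(2) W(1) zero_less_Suc] ..
    also have "A *\<^sub>v col W 0 = e \<cdot>\<^sub>v col W 0"
      unfolding W(3) using v A by (simp add: mult_mat_vec smult_smult_assoc mult.commute)
    also have "mat_adjoint W *\<^sub>v (e \<cdot>\<^sub>v col W 0) = e \<cdot>\<^sub>v col (mat_adjoint W * W) 0"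
      unfolding col_mult2[OF aW W(1) zero_less_Suc] 
      by (rule mult_mat_vec[OF aW]) (metis W(1) carrier_matD(1) col_dim)
    also have "\<dots> = e \<cdot>\<^sub>v unit_vec ?n 0" unfolding unitary_matD[OF W(2,1)] by simp
    finally have c0: "col A' 0 = e \<cdot>\<^sub>v unit_vec ?n 0" .
    have col0: "A' $$ (Suc i, 0) = 0" if "i < m" for i
      using arg_cong[OF c0, of "\<lambda>v. v $ Suc i"] that A' by simp
    \<comment> \<open>Row 0 and column 0 have equal norms, and column 0 has only its diagonal entry;
      hence the squared moduli of the other entries of row 0 add up to zero.\<close>
    have "(\<Sum>k<?n. A' $$ (0, k) * cnj (A' $$ (0, k))) = (\<Sum>k<?n. cnj (A' $$ (k, 0)) * A' $$ (k, 0))"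
      by (rule index_normal_mat[OF normal A']) auto
    then have "(\<Sum>k<m. A' $$ (0, Suc k) * cnj (A' $$ (0, Suc k))) = 0"
      using col0 by (simp only: sum.lessThan_Suc_shift) (simp add: mult.commute)
    then have "complex_of_real (\<Sum>k<m. (cmod (A' $$ (0, Suc k)))\<^sup>2) = 0"
      by (simp add: complex_norm_square del: of_real_power)
    then have "(\<Sum>k<m. (cmod (A' $$ (0, Suc k)))\<^sup>2) = 0" by (simp only: of_real_eq_0_iff)
    then have row0: "A' $$ (0, Suc k) = 0" if "k < m" for k
      using that by (subst (asm) sum_nonneg_eq_0_iff) auto
    define A3 where "A3 = mat m m (\<lambda>(i, j). A' $$ (Suc i, Suc j))"
    have A3: "A3 \<in> carrier_mat m m" by (simp add: A3_def)
    have "normal_mat A3" unfolding normal_mat_def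
    proof (rule eq_matI)
      show "dim_row (A3 * mat_adjoint A3) = dim_row (mat_adjoint A3 * A3)"
        "dim_col (A3 * mat_adjoint A3) = dim_col (mat_adjoint A3 * A3)"
        using A3 mat_adjoint_carrier[OF A3] by auto
      fix i j assume "i < dim_row (mat_adjoint A3 * A3)" "j < dim_col (mat_adjoint A3 * A3)"
      then have ij: "i < m" "j < m" using A3 mat_adjoint_carrier[OF A3] by auto
      \<comment> \<open>Normality of \<open>A'\<close> passes to the block because the border terms
        \<open>k = 0\<close> vanish on both sides.\<close>
      have "(\<Sum>k<?n. A' $$ (Suc i, k) * cnj (A' $$ (Suc j, k)))
          = (\<Sum>k<?n. cnj (A' $$ (k, Suc i)) * A' $$ (k, Suc j))"
        using ij by (intro index_normal_mat[OF normal A']) auto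
      then have "(\<Sum>k<m. A' $$ (Suc i, Suc k) * cnj (A' $$ (Suc j, Suc k)))
          = (\<Sum>k<m. cnj (A' $$ (Suc k, Suc i)) * A' $$ (Suc k, Suc j))"
        using col0[OF ij(1)] row0[OF ij(1)] by (simp only: sum.lessThan_Suc_shift) simp
      then show "(A3 * mat_adjoint A3) $$ (i, j) = (mat_adjoint A3 * A3) $$ (i, j)"
        using ij by (simp add: index_mult_mat_sum[OF A3 mat_adjoint_carrier[OF A3]]
            index_mult_mat_sum[OF mat_adjoint_carrier[OF A3] A3] mat_adjoint_index[OF A3])
          (simp add: A3_def)
    qed
    from Suc.IH[OF this A3] obtain P3 d3 where P3: "P3 \<in> carrier_mat m m" "unitary_mat P3"
      and A3_eq: "A3 = spectral_mat m P3 d3" by blast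
    \<comment> \<open>The block diagonal matrix with blocks 1 and \<open>P3\<close>;
      \<open>d\<close> prepends the corner entry of \<open>A'\<close> to the eigenvalues of the
      block.\<close>
    define P' where "P' = mat ?n ?n (\<lambda>(i, j). case i of 0 \<Rightarrow> of_bool (j = 0)
        | Suc i' \<Rightarrow> (case j of 0 \<Rightarrow> 0 | Suc j' \<Rightarrow> P3 $$ (i', j')))"
    define d where "d = (\<lambda>i. case i of 0 \<Rightarrow> A' $$ (0, 0) | Suc i' \<Rightarrow> d3 i')"
    have P': "P' \<in> carrier_mat ?n ?n" by (simp add: P'_def)
    note aP' = mat_adjoint_carrier[OF P']
    have P'_simps: "P' $$ (0, 0) = 1" "\<And>i. i < m \<Longrightarrow> P' $$ (0, Suc i) = 0"
      "\<And>i. i < m \<Longrightarrow> P' $$ (Suc i, 0) = 0"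
      "\<And>i j. i < m \<Longrightarrow> j < m \<Longrightarrow> P' $$ (Suc i, Suc j) = P3 $$ (i, j)"
      by (auto simp: P'_def)
    have P3_orth: "(\<Sum>k<m. cnj (P3 $$ (k, i)) * P3 $$ (k, j)) = of_bool (i = j)"
      if "i < m" "j < m" for i j
      using arg_cong[OF unitary_matD(2)[OF P3(2,1)], of "\<lambda>M. M $$ (i, j)"] that
      by (simp add: index_mult_mat_sum[OF mat_adjoint_carrier[OF P3(1)] P3(1)] mat_adjoint_index[OF P3(1)])
    have uP': "unitary_mat P'"
    proof (rule unitary_matI[OF P'], rule eq_matI)
      show "dim_row (mat_adjoint P' * P') = dim_row (1\<^sub>m ?n :: complex mat)"
        "dim_col (mat_adjoint P' * P') = dim_col (1\<^sub>m ?n :: complex mat)"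
        using P' aP' by auto
      fix i j assume "i < dim_row (1\<^sub>m ?n :: complex mat)" "j < dim_col (1\<^sub>m ?n :: complex mat)"
      then have ij: "i < ?n" "j < ?n" by auto
      have "(mat_adjoint P' * P') $$ (i, j) = (\<Sum>k<?n. cnj (P' $$ (k, i)) * P' $$ (k, j))"
        using ij by (simp add: index_mult_mat_sum[OF aP' P'] mat_adjoint_index[OF P'] del: sum.lessThan_Suc)
      then show "(mat_adjoint P' * P') $$ (i, j) = 1\<^sub>m ?n $$ (i, j)"
        using ij P3_orth
        by (cases i; cases j)
          (simp_all only: sum.lessThan_Suc_shift, simp_all add: P'_simps)
    qed
    have A'_eq: "A' = spectral_mat ?n P' d"
    proof (rule eq_matI)
      show "dim_row A' = dim_row (spectral_mat ?n P' d)"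
        "dim_col A' = dim_col (spectral_mat ?n P' d)"
        using A' spectral_mat_carrier[OF P', of d] by auto
      fix i j assume "i < dim_row (spectral_mat ?n P' d)"
        "j < dim_col (spectral_mat ?n P' d)"
      then have ij: "i < ?n" "j < ?n" using spectral_mat_carrier[OF P', of d] by auto
      have "A' $$ (Suc i', Suc j') = (\<Sum>l<m. P3 $$ (i', l) * d3 l * cnj (P3 $$ (j', l)))"
        if "i' < m" "j' < m" for i' j'
      proof -
        have "A' $$ (Suc i', Suc j') = A3 $$ (i', j')" using that by (simp add: A3_def)
        then show ?thesis using index_spectral_mat[OF P3(1) that, of d3] A3_eq by simp
      qed
      then show "A' $$ (i, j) = (spectral_mat ?n P' d) $$ (i, j)"
        unfolding index_spectral_mat[OF P' ij]
        using ij by (cases i; cases j)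
          (simp_all only: sum.lessThan_Suc_shift, simp_all add: P'_simps d_def col0 row0)
    qed
    \<comment> \<open>Undoing the change of basis turns the eigenbasis \<open>P'\<close> of
      \<open>A'\<close> into the eigenbasis \<open>W * P'\<close> of \<open>A\<close>.\<close>
    have "A = W * (A' * mat_adjoint W)"
    proof -
      have "W * (A' * mat_adjoint W) = W * (mat_adjoint W * (A * (W * mat_adjoint W)))"
        unfolding A'_def using A W aW by (simp add: assoc_mult_mat[of _ ?n ?n _ ?n _ ?n] mult_carrier_mat[of _ ?n ?n _ ?n])
      also have "\<dots> = A" using A by (simp add: unitary_cancel[OF W(2,1)] unitary_matD[OF W(2,1)])
      finally show ?thesis by simp
    qed
    also have "\<dots> = W * P' * mat_diag ?n d * (mat_adjoint P' * mat_adjoint W)"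
      unfolding A'_eq spectral_mat_def using W aW P' aP' mat_diag_dim[of ?n d]
      by (simp add: assoc_mult_mat[of _ ?n ?n _ ?n _ ?n] mult_carrier_mat[of _ ?n ?n _ ?n])
    also have "mat_adjoint P' * mat_adjoint W = mat_adjoint (W * P')"
      by (rule mat_adjoint_mult[OF W(1) P', symmetric])
    finally have "A = spectral_mat ?n (W * P') d" unfolding spectral_mat_def .
    then show ?case
      using unitary_mat_mult[OF W(2,1) uP' P'] W(1) P' by (intro exI[of _ "W * P'"] exI[of _ d]) auto
  qed
  then show thesis using that by blast
qed

section \<open>Spectral representations and their eigenvalues\<close>

lemma mat_diag_cong:
  assumes "\<And>i. i < n \<Longrightarrow> f i = g i"
  shows "mat_diag n f = mat_diag n g"
  using assms by (intro eq_matI) (auto simp: mat_diag_def)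

lemma spectral_mat_cong:
  assumes "\<And>i. i < n \<Longrightarrow> f i = g i"
  shows "spectral_mat n P f = spectral_mat n P g"
  unfolding spectral_mat_def using mat_diag_cong[of n f g, OF assms] by simp

lemma mat_adjoint_spectral_mat:
  assumes "P \<in> carrier_mat n n"
  shows "mat_adjoint (spectral_mat n P d) = spectral_mat n P (\<lambda>i. cnj (d i))"
proof -
  note a = mat_adjoint_carrier[OF assms]
  have "mat_adjoint (spectral_mat n P d) = P * (mat_diag n (\<lambda>i. cnj (d i)) * mat_adjoint P)"
    unfolding spectral_mat_def mat_adjoint_mult[OF mult_carrier_mat[OF assms mat_diag_dim] a]
      mat_adjoint_mult[OF assms mat_diag_dim] mat_adjoint_diag mat_adjoint_adjoint[OF assms] ..
  then show ?thesis
    unfolding spectral_mat_def using assms a mat_diag_dim by (simp add: assoc_mult_mat[of _ n n _ n _ n] mult_carrier_mat[of _ n n _ n])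
qed

lemma spectral_mat_mult_vecs:
  assumes P: "P \<in> carrier_mat n n" "unitary_mat P"
  shows "spectral_mat n P d * P = P * mat_diag n d"
    and "mat_adjoint P * spectral_mat n P d = mat_diag n d * mat_adjoint P"
proof -
  note a = mat_adjoint_carrier[OF P(1)] and D = mat_diag_dim[of n d]
  have "spectral_mat n P d * P = P * mat_diag n d * (mat_adjoint P * P)"
    unfolding spectral_mat_def using P a D by (simp add: assoc_mult_mat[of _ n n _ n _ n] mult_carrier_mat[of _ n n _ n])
  then show "spectral_mat n P d * P = P * mat_diag n d"
    using right_mult_one_mat[OF mult_carrier_mat[OF P(1) D]] by (simp add: unitary_matD[OF P(2,1)])
  have "mat_adjoint P * spectral_mat n P d = (mat_adjoint P * P) * (mat_diag n d * mat_adjoint P)"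
    unfolding spectral_mat_def using P a D by (simp add: assoc_mult_mat[of _ n n _ n _ n] mult_carrier_mat[of _ n n _ n])
  then show "mat_adjoint P * spectral_mat n P d = mat_diag n d * mat_adjoint P"
    using left_mult_one_mat[OF mult_carrier_mat[OF D a]] by (simp add: unitary_matD[OF P(2,1)])
qed

lemma spectral_mat_mult:
  assumes P: "P \<in> carrier_mat n n" "unitary_mat P"
  shows "spectral_mat n P d * spectral_mat n P e = spectral_mat n P (\<lambda>i. d i * e i)"
proof -
  note a = mat_adjoint_carrier[OF P(1)]
  have "spectral_mat n P d * spectral_mat n P e = P * mat_diag n d * (mat_adjoint P * spectral_mat n P e)"
    using P a spectral_mat_carrier[OF P(1)] mat_diag_dim
    by (simp add: spectral_mat_def[of n P d] assoc_mult_mat[of _ n n _ n _ n] mult_carrier_mat[of _ n n _ n])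
  also have "\<dots> = P * (mat_diag n d * mat_diag n e) * mat_adjoint P"
    using P a mat_diag_dim[of n d] mat_diag_dim[of n e]
    by (simp del: mat_diag_diag add: spectral_mat_mult_vecs(2)[OF P] assoc_mult_mat[of _ n n _ n _ n] mult_carrier_mat[of _ n n _ n])
  finally show ?thesis by (simp add: spectral_mat_def)
qed

lemma spectral_mat_one:
  assumes P: "P \<in> carrier_mat n n" "unitary_mat P"
  shows "spectral_mat n P (\<lambda>i. 1) = 1\<^sub>m n"
  using P by (simp add: spectral_mat_def unitary_matD[OF P(2,1)])

lemma spectral_mat_unitary:
  assumes P: "P \<in> carrier_mat n n" "unitary_mat P" and "\<And>j. j < n \<Longrightarrow> cmod (d j) = 1"
  shows "unitary_mat (spectral_mat n P d)"
proof (rule unitary_matI[OF spectral_mat_carrier[OF P(1)]])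
  have "cnj (d j) * d j = 1" if "j < n" for j
    using complex_norm_square[of "d j"] assms(3)[OF that] by (simp add: mult.commute)
  then have "spectral_mat n P (\<lambda>i. cnj (d i) * d i) = spectral_mat n P (\<lambda>i. 1)"
    by (intro spectral_mat_cong) auto
  then show "mat_adjoint (spectral_mat n P d) * spectral_mat n P d = 1\<^sub>m n"
    by (simp add: mat_adjoint_spectral_mat[OF P(1)] spectral_mat_mult[OF P] spectral_mat_one[OF P])
qed

text \<open>The product of the adjoint with the matrix has spectral values
  \<open>cnj (d i) * d i\<close> and equals the identity; conjugating by \<open>P\<close> shows that
  the diagonal matrix of these values is the identity too.\<close>

lemma unitary_spectrum:
  assumes P: "P \<in> carrier_mat n n" "unitary_mat P" and U: "unitary_mat (spectral_mat n P d)" and "j < n"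
  shows "cmod (d j) = 1"
proof -
  have "spectral_mat n P (\<lambda>i. cnj (d i) * d i) = 1\<^sub>m n"
    using unitary_matD(2)[OF U spectral_mat_carrier[OF P(1)]]
    by (simp add: mat_adjoint_spectral_mat[OF P(1)] spectral_mat_mult[OF P])
  with spectral_mat_mult_vecs(2)[OF P, of "\<lambda>i. cnj (d i) * d i"]
  have "mat_adjoint P = mat_diag n (\<lambda>i. cnj (d i) * d i) * mat_adjoint P"
    using mat_adjoint_carrier[OF P(1)] by simp
  then have "mat_adjoint P * P = mat_diag n (\<lambda>i. cnj (d i) * d i) * (mat_adjoint P * P)"
    using assoc_mult_mat[OF mat_diag_dim mat_adjoint_carrier[OF P(1)] P(1)] by metis
  then have "1\<^sub>m n = mat_diag n (\<lambda>i. cnj (d i) * d i)"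
    by (simp only: unitary_matD[OF P(2,1)] right_mult_one_mat[OF mat_diag_dim])
  from arg_cong[OF this, of "\<lambda>M. M $$ (j, j)"] \<open>j < n\<close>
  have "d j * cnj (d j) = 1" by (simp add: mat_diag_def mult.commute)
  then have "(cmod (d j))\<^sup>2 = 1\<^sup>2" using complex_mod_mult_cnj[of "d j"] by simp
  then show ?thesis by (rule power2_eq_imp_eq) auto
qed

text \<open>Similar matrices share their characteristic polynomial, and that of a diagonal matrix
  factors over its entries; multiplicities are thus those of the enumeration
  \<open>d\<close>.\<close>

lemma eigenvalue_mset_spectral_mat:
  assumes P: "P \<in> carrier_mat n n" "unitary_mat P"
  shows "eigenvalue_mset (spectral_mat n P d) = image_mset d (mset_set {..<n})"
proof -
  have "similar_mat (spectral_mat n P d) (mat_diag n d)"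
    unfolding similar_mat_def
    by (intro exI, rule similar_mat_witI[of P "mat_adjoint P" n])
      (use P mat_adjoint_carrier[OF P(1)] spectral_mat_carrier[OF P(1)] in
        \<open>auto simp: unitary_matD[OF P(2,1)] spectral_mat_def\<close>)
  then have "char_poly (spectral_mat n P d) = char_poly (mat_diag n d)"
    by (rule char_poly_similar)
  also have "\<dots> = (\<Prod>a\<leftarrow>diag_mat (mat_diag n d). [:- a, 1:])"
    by (rule char_poly_upper_triangular[OF mat_diag_dim]) (auto simp: mat_diag_def upper_triangular_def)
  also have "diag_mat (mat_diag n d) = map d [0..<n]"
    by (auto simp: diag_mat_def mat_diag_def)
  finally have cp: "char_poly (spectral_mat n P d) = (\<Prod>a\<leftarrow>map d [0..<n]. [:- a, 1:])" .
  have "proots (\<Prod>a\<leftarrow>as. [:- a, 1:]) = mset as" for as :: "complex list"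
    by (induction as) (simp_all add: proots_mult prod_list_zero_iff image_iff del: mult_pCons_left)
  from this[of "map d [0..<n]"] show ?thesis
    unfolding eigenvalue_mset_def cp by (simp add: lessThan_atLeast0)
qed

lemma abs_args_desc_spectral_mat:
  assumes P: "P \<in> carrier_mat n n" "unitary_mat P"
  shows "abs_args_desc (spectral_mat n P d)
    = descending_list_of_multiset (image_mset (\<lambda>j. \<bar>Arg (d j)\<bar>) (mset_set {..<n}))"
  by (simp add: abs_args_desc_def eigenvalue_mset_spectral_mat[OF P] image_mset.compositionality comp_def)

lemma singular_values_desc_spectral_mat:
  assumes P: "P \<in> carrier_mat n n" "unitary_mat P"
  shows "singular_values_desc (spectral_mat n P d)
    = descending_list_of_multiset (image_mset (\<lambda>j. cmod (d j)) (mset_set {..<n}))"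
proof -
  have "sqrt (Re (cnj z * z)) = cmod z" for z
    by (simp add: cmod_def power2_eq_square)
  then show ?thesis
    by (simp add: singular_values_desc_def mat_adjoint_spectral_mat[OF P(1)] spectral_mat_mult[OF P]
        eigenvalue_mset_spectral_mat[OF P] image_mset.compositionality comp_def del: complex_cnj_mult)
qed

lemma unitary_mat_spectral:
  assumes "unitary_mat U" "U \<in> carrier_mat n n"
  obtains P d where "P \<in> carrier_mat n n" "unitary_mat P" "U = spectral_mat n P d"
    "\<And>j. j < n \<Longrightarrow> cmod (d j) = 1"
proof -
  have "normal_mat U" by (simp add: normal_mat_def unitary_matD[OF assms])
  then obtain P d where "P \<in> carrier_mat n n" "unitary_mat P" "U = spectral_mat n P d"
    using normal_mat_diagonalizable[OF _ assms(2)] by blast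
  with unitary_spectrum assms(1) that show thesis by blast
qed

section \<open>Row and column norms of unitary matrices, and Ky Fan's principle\<close>

lemma unitary_col_norm:
  assumes "unitary_mat P" "P \<in> carrier_mat n n" "j < n"
  shows "(\<Sum>i<n. (cmod (P $$ (i, j)))\<^sup>2) = 1"
proof -
  have "complex_of_real (\<Sum>i<n. (cmod (P $$ (i, j)))\<^sup>2) = (mat_adjoint P * P) $$ (j, j)"
    using assms by (simp add: index_mult_mat_sum[OF mat_adjoint_carrier[OF assms(2)] assms(2)]
        mat_adjoint_index[OF assms(2)] complex_norm_square mult.commute del: of_real_power)
  then have "complex_of_real (\<Sum>i<n. (cmod (P $$ (i, j)))\<^sup>2) = 1"
    using assms by (simp add: unitary_matD[OF assms(1,2)])
  then show ?thesis by (simp only: of_real_eq_1_iff)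
qed

lemma unitary_row_norm:
  assumes "unitary_mat P" "P \<in> carrier_mat n n" "i < n"
  shows "(\<Sum>j<n. (cmod (P $$ (i, j)))\<^sup>2) = 1"
  using unitary_col_norm[OF unitary_mat_adjoint[OF assms(1,2)] mat_adjoint_carrier[OF assms(2)] assms(3)]
  by (simp add: mat_adjoint_index[OF assms(2)] assms(3))

text \<open>The boundedness that later allows convergent subsequences of eigenbases to be
  extracted.\<close>

lemma unitary_entry_bound:
  assumes "unitary_mat P" "P \<in> carrier_mat n n" "i < n" "j < n"
  shows "cmod (P $$ (i, j)) \<le> 1"
proof -
  have "(cmod (P $$ (i, j)))\<^sup>2 \<le> (\<Sum>j<n. (cmod (P $$ (i, j)))\<^sup>2)"
    by (rule member_le_sum) (use assms in auto)
  then show ?thesis using unitary_row_norm[OF assms(1-3)] by (simp add: power_le_one_iff abs_square_le_1)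
qed

text \<open>Ky Fan's maximum principle, by way of the doubly stochastic weights
  \<open>\<bar>R $$ (j, l)\<bar>\<^sup>2\<close>.\<close>

lemma sum_diag_le_ksum:
  assumes Q: "Q \<in> carrier_mat n n" "unitary_mat Q" and W: "W \<in> carrier_mat n n" "unitary_mat W"
    and S: "S \<subseteq> {..<n}"
  shows "(\<Sum>j\<in>S. cmod ((mat_adjoint W * spectral_mat n Q g * W) $$ (j, j)))
    \<le> ksum (card S) (image_mset (\<lambda>l. cmod (g l)) (mset_set {..<n}))"
proof -
  \<comment> \<open>The eigenbasis \<open>Q\<close> expressed in the basis \<open>W\<close>; the
    conjugated matrix has the same eigenvalues \<open>g\<close> and the eigenbasis
    \<open>R\<close>.\<close>
  define R where "R = mat_adjoint W * Q"
  note aW = mat_adjoint_carrier[OF W(1)] and aQ = mat_adjoint_carrier[OF Q(1)]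
  have R: "R \<in> carrier_mat n n" "unitary_mat R"
    unfolding R_def using unitary_mat_mult[OF unitary_mat_adjoint[OF W(2,1)] aW Q(2,1)] aW Q by auto
  have "mat_adjoint W * spectral_mat n Q g * W = spectral_mat n R g"
    unfolding spectral_mat_def R_def mat_adjoint_mult[OF aW Q(1)] mat_adjoint_adjoint[OF W(1)]
    using W Q aW aQ mat_diag_dim[of n g] by (simp add: assoc_mult_mat[of _ n n _ n _ n] mult_carrier_mat[of _ n n _ n])
  moreover have Sn: "j < n" if "j \<in> S" for j using that S by auto
  ultimately have entry: "cmod ((mat_adjoint W * spectral_mat n Q g * W) $$ (j, j))
      \<le> (\<Sum>l<n. cmod (g l) * (cmod (R $$ (j, l)))\<^sup>2)" if "j \<in> S" for j
    using that
    by (auto simp: index_spectral_mat[OF R(1) Sn Sn] norm_mult power2_eq_square mult_ac intro!: sum_norm_le)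
  have fin: "finite S" using S finite_subset by blast
  \<comment> \<open>\<open>c l\<close> is the part of column \<open>l\<close> of \<open>R\<close>
    lying in the rows of \<open>S\<close>: at most 1 because columns have norm 1, and of total
    \<open>card S\<close> because rows do.\<close>
  define c where "c l = (\<Sum>j\<in>S. (cmod (R $$ (j, l)))\<^sup>2)" for l
  have "(\<Sum>j\<in>S. cmod ((mat_adjoint W * spectral_mat n Q g * W) $$ (j, j)))
      \<le> (\<Sum>j\<in>S. \<Sum>l<n. cmod (g l) * (cmod (R $$ (j, l)))\<^sup>2)"
    by (intro sum_mono entry)
  also have "\<dots> = (\<Sum>l<n. cmod (g l) * c l)"
    unfolding c_def sum_distrib_left by (rule sum.swap)
  also have "\<dots> \<le> ksum (card S) (image_mset (\<lambda>l. cmod (g l)) (mset_set {..<n}))"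
  proof (rule weighted_sum_le_ksum)
    show "0 \<le> c l" for l unfolding c_def by (intro sum_nonneg) auto
    show "c l \<le> 1" if "l < n" for l
      using unitary_col_norm[OF R(2,1) that] sum_mono2[OF _ S, of "\<lambda>j. (cmod (R $$ (j, l)))\<^sup>2"]
      unfolding c_def by auto
    have "(\<Sum>l<n. c l) = (\<Sum>j\<in>S. \<Sum>l<n. (cmod (R $$ (j, l)))\<^sup>2)"
      unfolding c_def by (rule sum.swap)
    also have "\<dots> = (\<Sum>j\<in>S. 1)"
      by (intro sum.cong refl unitary_row_norm[OF R(2,1)] Sn)
    finally show "(\<Sum>l<n. c l) = real (card S)" by simp
    show "card S \<le> n" using card_mono[OF finite_lessThan S] by simp
  qed
  finally show ?thesis .
qed

section \<open>Convergent subsequences and perturbation of arguments\<close>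

text \<open>Bolzano-Weierstrass: extract a subsequence with monotone real parts, then from it one
  with monotone imaginary parts; bounded monotone sequences converge.\<close>

lemma bounded_complex_convergent_subseq:
  fixes f :: "nat \<Rightarrow> complex"
  assumes "\<And>m. cmod (f m) \<le> B"
  obtains r :: "nat \<Rightarrow> nat" where "strict_mono r" "convergent (f \<circ> r)"
proof -
  obtain r1 :: "nat \<Rightarrow> nat" where r1: "strict_mono r1" "monoseq (\<lambda>m. Re (f (r1 m)))"
    using seq_monosub[of "\<lambda>m. Re (f m)"] by auto
  obtain r2 :: "nat \<Rightarrow> nat" where r2: "strict_mono r2" "monoseq (\<lambda>m. Im (f (r1 (r2 m))))"
    using seq_monosub[of "\<lambda>m. Im (f (r1 m))"] by auto
  have "convergent (\<lambda>m. Re (f (r1 m)))"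
    by (rule Bseq_monoseq_convergent[OF _ r1(2)], rule BseqI'[of _ B])
      (metis abs_Re_le_cmod assms order_trans real_norm_def)
  then have re: "convergent (\<lambda>m. Re (f (r1 (r2 m))))"
    using convergent_subseq_convergent[OF _ r2(1)] by (simp add: comp_def)
  have im: "convergent (\<lambda>m. Im (f (r1 (r2 m))))"
    by (rule Bseq_monoseq_convergent[OF _ r2(2)], rule BseqI'[of _ B])
      (metis abs_Im_le_cmod assms order_trans real_norm_def)
  have "convergent (f \<circ> (r1 \<circ> r2))"
    using re im tendsto_complex_iff[of _ "Complex _ _"] unfolding convergent_def comp_def
    by (metis complex.sel)
  with strict_mono_o[OF r1(1) r2(1)] show thesis by (rule that)
qed

text \<open>Members are treated one after another: each further extraction preserves the convergence
  already achieved.\<close>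

lemma bounded_complex_family_convergent_subseq:
  fixes f :: "'a \<Rightarrow> nat \<Rightarrow> complex"
  assumes "finite I" "\<And>i m. i \<in> I \<Longrightarrow> cmod (f i m) \<le> B"
  shows "\<exists>r :: nat \<Rightarrow> nat. strict_mono r \<and> (\<forall>i\<in>I. convergent (f i \<circ> r))"
  using assms
proof (induction I rule: finite_induct)
  case empty
  show ?case by (intro exI[of _ id]) (auto simp: strict_mono_def)
next
  case (insert i I)
  have "\<exists>r :: nat \<Rightarrow> nat. strict_mono r \<and> (\<forall>j\<in>I. convergent (f j \<circ> r))"
    by (rule insert.IH) (auto intro: insert.prems)
  then obtain r :: "nat \<Rightarrow> nat" where r: "strict_mono r" "\<forall>j\<in>I. convergent (f j \<circ> r)" by blast
  obtain q :: "nat \<Rightarrow> nat" where q: "strict_mono q" "convergent ((f i \<circ> r) \<circ> q)"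
    using bounded_complex_convergent_subseq[of "f i \<circ> r" B] insert.prems by auto
  have "convergent (f j \<circ> (r \<circ> q))" if "j \<in> insert i I" for j
    using that r(2) q convergent_subseq_convergent[OF _ q(1), of "f j \<circ> r"] by (auto simp: comp_assoc)
  then show ?case using strict_mono_o[OF r(1) q(1)] by blast
qed

text \<open>The map from \<open>z\<close> to \<open>\<bar>Arg z\<bar>\<close> folds the circle onto
  its upper half by conjugation, which does not increase distances, and there a chord of length
  \<open>x\<close> spans the angle \<open>2 * arcsin (x / 2)\<close>. In particular the jump of
  \<open>Arg\<close> at -1 disappears.\<close>

lemma abs_Arg_diff_le:
  assumes "cmod z = 1" "cmod w = 1"
  shows "\<bar>\<bar>Arg z\<bar> - \<bar>Arg w\<bar>\<bar> \<le> 2 * arcsin (cmod (z - w) / 2)"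
proof -
  define a b where "a = Arg z" and "b = Arg w"
  define p where "p = \<bar>\<bar>a\<bar> - \<bar>b\<bar>\<bar> / 2"
  have z: "z = cis a" and w: "w = cis b"
    using rcis_cmod_Arg[of z] rcis_cmod_Arg[of w] assms by (simp_all add: rcis_def a_def b_def)
  have ab: "\<bar>a\<bar> \<le> pi" "\<bar>b\<bar> \<le> pi" using Arg_bounded[of z] Arg_bounded[of w] unfolding a_def b_def by linarith+
  have "\<bar>\<bar>a\<bar> - \<bar>b\<bar>\<bar> \<le> pi" by (rule abs_leI) (use ab in linarith)+
  then have p: "0 \<le> p" "p \<le> pi / 2" by (simp_all add: p_def)
  \<comment> \<open>The folding inequality: replacing \<open>a\<close> and \<open>b\<close> by their
    absolute values keeps the cosines and can only enlarge the product of the sines.\<close>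
  have "sin a * sin b \<le> \<bar>sin a\<bar> * \<bar>sin b\<bar>" by (metis abs_ge_self abs_mult)
  also have "\<bar>sin a\<bar> = sin \<bar>a\<bar>" using ab(1) sin_ge_zero[of "\<bar>a\<bar>"] by (cases "0 \<le> a") auto
  also have "\<bar>sin b\<bar> = sin \<bar>b\<bar>" using ab(2) sin_ge_zero[of "\<bar>b\<bar>"] by (cases "0 \<le> b") auto
  finally have "cos (a - b) \<le> cos (\<bar>a\<bar> - \<bar>b\<bar>)" by (simp add: cos_diff)
  also have "cos (\<bar>a\<bar> - \<bar>b\<bar>) = cos (2 * p)" by (simp add: p_def)
  also have "\<dots> = 1 - 2 * (sin p)\<^sup>2" by (rule cos_double_sin)
  finally have "4 * (sin p)\<^sup>2 \<le> 2 - 2 * cos (a - b)" by simp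
  also have "\<dots> = (cmod (z - w))\<^sup>2"
  proof -
    have "(cmod (z - w))\<^sup>2 = (cos a - cos b)\<^sup>2 + (sin a - sin b)\<^sup>2" by (simp add: z w cmod_power2)
    also have "\<dots> = ((sin a)\<^sup>2 + (cos a)\<^sup>2) + ((sin b)\<^sup>2 + (cos b)\<^sup>2) - 2 * (cos a * cos b + sin a * sin b)"
      by (simp add: power2_diff algebra_simps)
    finally show ?thesis by (simp add: cos_diff)
  qed
  finally have "(sin p)\<^sup>2 \<le> (cmod (z - w) / 2)\<^sup>2" by (simp add: power_divide)
  then have le: "sin p \<le> cmod (z - w) / 2" by (rule power2_le_imp_le) simp
  \<comment> \<open>Places the half chord in the domain on which \<open>arcsin\<close> is
    monotone.\<close>
  have "cmod (z - w) \<le> 2" using norm_triangle_ineq4[of z w] assms by simp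
  then have "arcsin (sin p) \<le> arcsin (cmod (z - w) / 2)"
    using le by (intro arcsin_le_arcsin) (auto intro: order_trans[OF _ sin_ge_minus_one])
  then show ?thesis using p by (simp add: arcsin_sin p_def a_def b_def)
qed

text \<open>Arc and chord agree to first order, so the absolute argument moves no faster, up to
  \<open>\<eta>\<close>, than the point itself.\<close>

lemma abs_Arg_sequence_bound:
  fixes z :: "nat \<Rightarrow> complex" and e :: "nat \<Rightarrow> real"
  assumes z: "\<And>m. cmod (z m) = 1" and w: "cmod w = 1"
    and e: "\<And>m. e m \<noteq> 0" "e \<longlonglongrightarrow> 0"
    and lim: "(\<lambda>m. (z m - w) / complex_of_real (e m)) \<longlonglongrightarrow> c"
    and "0 < \<eta>"
  shows "\<forall>\<^sub>F m in sequentially. \<bar>\<bar>Arg (z m)\<bar> - \<bar>Arg w\<bar>\<bar> \<le> \<bar>e m\<bar> * (cmod c + \<eta>)"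
proof -
  define x where "x m = cmod (z m - w)" for m
  have xe: "(\<lambda>m. x m / \<bar>e m\<bar>) \<longlonglongrightarrow> cmod c"
    using tendsto_norm[OF lim] by (simp add: x_def norm_divide)
  have "(\<lambda>m. x m / \<bar>e m\<bar> * \<bar>e m\<bar>) \<longlonglongrightarrow> cmod c * \<bar>0\<bar>"
    by (intro tendsto_mult xe tendsto_rabs e(2))
  then have x0: "x \<longlonglongrightarrow> 0" using e(1) by simp
  \<comment> \<open>Caratheodory's form of the derivative, with a continuous factor
    \<open>h\<close>, avoids dividing by \<open>x m\<close>, which may be zero.\<close>
  have "((\<lambda>x::real. 2 * arcsin (x / 2)) has_real_derivative 1) (at 0)"
    by (auto intro!: derivative_eq_intros)
  then obtain h where h: "\<And>x. 2 * arcsin (x / 2) = h x * x" "isCont h 0" "h 0 = (1::real)"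
    unfolding CARAT_DERIV by auto
  have "(\<lambda>m. h (x m) * (x m / \<bar>e m\<bar>)) \<longlonglongrightarrow> 1 * cmod c"
    using isCont_tendsto_compose[OF h(2) x0] h(3) by (intro tendsto_mult xe) simp
  then have "(\<lambda>m. 2 * arcsin (x m / 2) / \<bar>e m\<bar>) \<longlonglongrightarrow> cmod c"
    by (simp add: h(1))
  then have "\<forall>\<^sub>F m in sequentially. 2 * arcsin (x m / 2) / \<bar>e m\<bar> < cmod c + \<eta>"
    by (rule order_tendstoD(2)) (use \<open>0 < \<eta>\<close> in simp)
  then show ?thesis
  proof eventually_elim
    case (elim m)
    then have "2 * arcsin (x m / 2) \<le> \<bar>e m\<bar> * (cmod c + \<eta>)"
      using e(1)[of m] by (simp add: field_simps)
    then show ?case using abs_Arg_diff_le[OF z w, of m] unfolding x_def by linarith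
  qed
qed

lemma index_spectral_mat_eigenvector:
  assumes P: "P \<in> carrier_mat n n" "unitary_mat P" and "i < n" "j < n"
  shows "(\<Sum>b<n. spectral_mat n P d $$ (i, b) * P $$ (b, j)) = P $$ (i, j) * d j"
    and "(\<Sum>a<n. cnj (P $$ (a, j)) * spectral_mat n P d $$ (a, i)) = d j * cnj (P $$ (i, j))"
proof -
  note a = mat_adjoint_carrier[OF P(1)] and U = spectral_mat_carrier[OF P(1), of d]
  show "(\<Sum>b<n. spectral_mat n P d $$ (i, b) * P $$ (b, j)) = P $$ (i, j) * d j"
    using arg_cong[OF spectral_mat_mult_vecs(1)[OF P, of d], of "\<lambda>M. M $$ (i, j)"] assms(3,4)
    by (simp add: index_mult_mat_sum[OF U P(1)] mat_diag_mult_right[OF P(1)] del: index_mult_mat)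
  show "(\<Sum>a<n. cnj (P $$ (a, j)) * spectral_mat n P d $$ (a, i)) = d j * cnj (P $$ (i, j))"
    using arg_cong[OF spectral_mat_mult_vecs(2)[OF P, of d], of "\<lambda>M. M $$ (j, i)"] assms(3,4)
    by (simp add: index_mult_mat_sum[OF a U] mat_diag_mult_left[OF a] mat_adjoint_index[OF P(1)] del: index_mult_mat)
qed

text \<open>Pairing \<open>U'\<close> with an eigenvector of \<open>U\<close> on the left and one of \<open>U'\<close> on the right isolates the
  difference of the two eigenvalues.\<close>

lemma eigenvalue_difference:
  fixes d d' :: "nat \<Rightarrow> complex"
  assumes P: "P \<in> carrier_mat n n" "unitary_mat P" and P': "P' \<in> carrier_mat n n" "unitary_mat P'"
    and "j < n"
  defines "U \<equiv> spectral_mat n P d" and "U' \<equiv> spectral_mat n P' d'"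
  shows "(d' j - d j) * (\<Sum>a<n. cnj (P $$ (a, j)) * P' $$ (a, j))
    = (\<Sum>a<n. \<Sum>b<n. cnj (P $$ (a, j)) * (U' $$ (a, b) - U $$ (a, b)) * P' $$ (b, j))"
proof -
  have "(\<Sum>a<n. \<Sum>b<n. cnj (P $$ (a, j)) * (U' $$ (a, b) - U $$ (a, b)) * P' $$ (b, j))
      = (\<Sum>a<n. cnj (P $$ (a, j)) * (\<Sum>b<n. U' $$ (a, b) * P' $$ (b, j)))
        - (\<Sum>a<n. \<Sum>b<n. cnj (P $$ (a, j)) * U $$ (a, b) * P' $$ (b, j))"
    by (simp add: sum_subtractf sum_distrib_left algebra_simps)
  also have "(\<Sum>a<n. \<Sum>b<n. cnj (P $$ (a, j)) * U $$ (a, b) * P' $$ (b, j))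
      = (\<Sum>b<n. (\<Sum>a<n. cnj (P $$ (a, j)) * U $$ (a, b)) * P' $$ (b, j))"
    unfolding sum_distrib_right by (rule sum.swap)
  also have "\<dots> = (\<Sum>b<n. d j * cnj (P $$ (b, j)) * P' $$ (b, j))"
    unfolding U_def using index_spectral_mat_eigenvector(2)[OF P _ \<open>j < n\<close>] by simp
  also have "(\<Sum>a<n. cnj (P $$ (a, j)) * (\<Sum>b<n. U' $$ (a, b) * P' $$ (b, j)))
      = (\<Sum>a<n. cnj (P $$ (a, j)) * (P' $$ (a, j) * d' j))"
    unfolding U'_def using index_spectral_mat_eigenvector(1)[OF P' _ \<open>j < n\<close>] by simp
  also have "(\<Sum>a<n. cnj (P $$ (a, j)) * (P' $$ (a, j) * d' j)) - (\<Sum>b<n. d j * cnj (P $$ (b, j)) * P' $$ (b, j))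
      = (d' j - d j) * (\<Sum>a<n. cnj (P $$ (a, j)) * P' $$ (a, j))"
    by (simp add: left_diff_distrib sum_distrib_left sum_subtractf mult_ac)
  finally show ?thesis ..
qed

text \<open>Unitarity as polynomial equations in the entries and their conjugates, a form that
  passes to entrywise limits.\<close>

lemma unitary_mat_index:
  assumes P: "P \<in> carrier_mat n n"
  shows "unitary_mat P \<longleftrightarrow> (\<forall>i<n. \<forall>j<n. (\<Sum>k<n. cnj (P $$ (k, i)) * P $$ (k, j)) = of_bool (i = j))"
proof -
  note a = mat_adjoint_carrier[OF P]
  have ix: "(mat_adjoint P * P) $$ (i, j) = (\<Sum>k<n. cnj (P $$ (k, i)) * P $$ (k, j))" if "i < n" "j < n" for i j
    using that by (simp add: index_mult_mat_sum[OF a P] mat_adjoint_index[OF P] del: index_mult_mat)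
  show ?thesis
  proof
    assume "unitary_mat P"
    then show "\<forall>i<n. \<forall>j<n. (\<Sum>k<n. cnj (P $$ (k, i)) * P $$ (k, j)) = of_bool (i = j)"
      by (simp add: ix[symmetric] unitary_matD(2)[OF _ P])
  next
    assume *: "\<forall>i<n. \<forall>j<n. (\<Sum>k<n. cnj (P $$ (k, i)) * P $$ (k, j)) = of_bool (i = j)"
    have "mat_adjoint P * P = 1\<^sub>m n"
    proof (rule eq_matI)
      show "dim_row (mat_adjoint P * P) = dim_row (1\<^sub>m n :: complex mat)"
        "dim_col (mat_adjoint P * P) = dim_col (1\<^sub>m n :: complex mat)"
        using P a by auto
      fix i j assume "i < dim_row (1\<^sub>m n :: complex mat)" "j < dim_col (1\<^sub>m n :: complex mat)"
      then show "(mat_adjoint P * P) $$ (i, j) = 1\<^sub>m n $$ (i, j)"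
        using ix[of i j] * by simp
    qed
    then show "unitary_mat P" by (rule unitary_matI[OF P])
  qed
qed

section \<open>Growth of the largest absolute arguments along a curve\<close>

text \<open>By compactness the eigenbases and eigenvalues of \<open>U m\<close> converge along a
  subsequence, and the limits diagonalise \<open>U0\<close>. The eigenbasis \<open>P\<close> is thus
  selected by the sequence, which takes care of multiple eigenvalues of \<open>U0\<close>; the
  quotients then converge by \<open>eigenvalue_difference\<close>.\<close>

lemma eigenvalue_sequence_derivative:
  fixes U :: "nat \<Rightarrow> complex mat" and e :: "nat \<Rightarrow> real"
  assumes U: "\<And>m. U m \<in> carrier_mat n n" "\<And>m. unitary_mat (U m)"
    and U0: "U0 \<in> carrier_mat n n" and D: "D \<in> carrier_mat n n"
    and e: "\<And>m. e m \<noteq> 0" "e \<longlonglongrightarrow> 0"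
    and quot: "\<And>i j. i < n \<Longrightarrow> j < n \<Longrightarrow>
      (\<lambda>m. (U m $$ (i, j) - U0 $$ (i, j)) / complex_of_real (e m)) \<longlonglongrightarrow> D $$ (i, j)"
  obtains r :: "nat \<Rightarrow> nat" and P d d' where
    "strict_mono r" "P \<in> carrier_mat n n" "unitary_mat P" "U0 = spectral_mat n P d"
    "\<And>m j. j < n \<Longrightarrow> cmod (d' m j) = 1"
    "\<And>m. eigenvalue_mset (U (r m)) = image_mset (d' m) (mset_set {..<n})"
    "\<And>j. j < n \<Longrightarrow> (\<lambda>m. (d' m j - d j) / complex_of_real (e (r m)))
      \<longlonglongrightarrow> (mat_adjoint P * D * P) $$ (j, j)"
proof -
  have "\<exists>Q d. Q \<in> carrier_mat n n \<and> unitary_mat Q \<and> U m = spectral_mat n Q d \<and> (\<forall>j<n. cmod (d j) = 1)" for m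
    using unitary_mat_spectral[OF U(2,1)] by metis
  then obtain Q d0 where Q: "\<And>m. Q m \<in> carrier_mat n n" "\<And>m. unitary_mat (Q m)"
    and Ud: "\<And>m. U m = spectral_mat n (Q m) (d0 m)" and d0: "\<And>m j. j < n \<Longrightarrow> cmod (d0 m j) = 1"
    by metis
  \<comment> \<open>The eigenvalues are stored as an extra column \<open>n\<close> beside the
    entries of \<open>Q m\<close>, so that one extraction makes everything converge; all these
    numbers are bounded by 1.\<close>
  define f where "f = (\<lambda>(i, j) m. if j < n then Q m $$ (i, j) else d0 m i)"
  have "\<exists>r :: nat \<Rightarrow> nat. strict_mono r \<and> (\<forall>x\<in>{..<n} \<times> {..n}. convergent (f x \<circ> r))"
    by (rule bounded_complex_family_convergent_subseq[of _ _ 1])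
      (auto simp: f_def d0 unitary_entry_bound[OF Q(2,1)])
  then obtain r :: "nat \<Rightarrow> nat" where r: "strict_mono r"
    and conv: "\<And>i j. i < n \<Longrightarrow> j \<le> n \<Longrightarrow> convergent (\<lambda>m. f (i, j) (r m))"
    by (auto simp: comp_def)
  define P where "P = mat n n (\<lambda>(i, j). lim (\<lambda>m. Q (r m) $$ (i, j)))"
  define d where "d j = lim (\<lambda>m. d0 (r m) j)" for j
  have P: "P \<in> carrier_mat n n" by (simp add: P_def)
  have Plim: "(\<lambda>m. Q (r m) $$ (i, j)) \<longlonglongrightarrow> P $$ (i, j)" if "i < n" "j < n" for i j
    using conv[OF that(1) less_imp_le[OF that(2)]] that by (simp add: P_def f_def convergent_LIMSEQ_iff)
  have dlim: "(\<lambda>m. d0 (r m) j) \<longlonglongrightarrow> d j" if "j < n" for j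
    using conv[OF that order_refl] by (simp add: d_def f_def convergent_LIMSEQ_iff)
  have er: "(\<lambda>m. e (r m)) \<longlonglongrightarrow> 0"
    using LIMSEQ_subseq_LIMSEQ[OF e(2) r] by (simp add: comp_def)
  have quot_r: "(\<lambda>m. (U (r m) $$ (i, j) - U0 $$ (i, j)) / complex_of_real (e (r m))) \<longlonglongrightarrow> D $$ (i, j)"
    if "i < n" "j < n" for i j
    using LIMSEQ_subseq_LIMSEQ[OF quot[OF that] r] by (simp add: comp_def)
  have inner: "(\<lambda>m. \<Sum>k<n. cnj (P $$ (k, i)) * Q (r m) $$ (k, j)) \<longlonglongrightarrow> (\<Sum>k<n. cnj (P $$ (k, i)) * P $$ (k, j))"
    if "i < n" "j < n" for i j
    using that by (intro tendsto_intros Plim) auto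
  have uP: "unitary_mat P"
    unfolding unitary_mat_index[OF P]
  proof (intro allI impI)
    fix i j assume ij: "i < n" "j < n"
    have "(\<lambda>m. \<Sum>k<n. cnj (Q (r m) $$ (k, i)) * Q (r m) $$ (k, j)) \<longlonglongrightarrow> (\<Sum>k<n. cnj (P $$ (k, i)) * P $$ (k, j))"
      using ij by (intro tendsto_intros Plim) auto
    moreover have "(\<Sum>k<n. cnj (Q (r m) $$ (k, i)) * Q (r m) $$ (k, j)) = of_bool (i = j)" for m
      using unitary_mat_index[OF Q(1)] Q(2) ij by blast
    ultimately have "(\<lambda>m. of_bool (i = j)) \<longlonglongrightarrow> (\<Sum>k<n. cnj (P $$ (k, i)) * P $$ (k, j))"
      by simp
    then show "(\<Sum>k<n. cnj (P $$ (k, i)) * P $$ (k, j)) = of_bool (i = j)"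
      by (rule LIMSEQ_unique[OF _ tendsto_const])
  qed
  have U0_eq: "U0 = spectral_mat n P d"
  proof (rule eq_matI)
    show "dim_row U0 = dim_row (spectral_mat n P d)" "dim_col U0 = dim_col (spectral_mat n P d)"
      using U0 spectral_mat_carrier[OF P, of d] by auto
    fix i j assume "i < dim_row (spectral_mat n P d)" "j < dim_col (spectral_mat n P d)"
    then have ij: "i < n" "j < n" using spectral_mat_carrier[OF P, of d] by auto
    \<comment> \<open>Since the quotients converge and their denominators tend to zero,
      \<open>U (r m)\<close> tends to \<open>U0\<close> entrywise.\<close>
    have "(\<lambda>m. (U (r m) $$ (i, j) - U0 $$ (i, j)) / complex_of_real (e (r m)) * complex_of_real (e (r m)))
        \<longlonglongrightarrow> D $$ (i, j) * complex_of_real 0"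
      by (intro tendsto_mult quot_r[OF ij] tendsto_of_real er)
    then have "(\<lambda>m. U (r m) $$ (i, j) - U0 $$ (i, j)) \<longlonglongrightarrow> 0" using e(1) by simp
    then have "(\<lambda>m. U (r m) $$ (i, j)) \<longlonglongrightarrow> U0 $$ (i, j)" by (simp add: LIM_zero_iff)
    moreover have "(\<lambda>m. U (r m) $$ (i, j)) \<longlonglongrightarrow> spectral_mat n P d $$ (i, j)"
      unfolding Ud index_spectral_mat[OF Q(1) ij] index_spectral_mat[OF P ij]
      using ij by (intro tendsto_intros Plim dlim) auto
    ultimately show "U0 $$ (i, j) = spectral_mat n P d $$ (i, j)" by (rule LIMSEQ_unique)
  qed
  have "(\<lambda>m. (d0 (r m) j - d j) / complex_of_real (e (r m))) \<longlonglongrightarrow> (mat_adjoint P * D * P) $$ (j, j)"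
    if j: "j < n" for j
  proof -
    \<comment> \<open>\<open>q m\<close> is the pairing of the limit eigenvector with the moving
      one, and \<open>N m\<close> the pairing with the difference quotient; their ratio is the
      quotient of the eigenvalues.\<close>
    define q where "q m = (\<Sum>k<n. cnj (P $$ (k, j)) * Q (r m) $$ (k, j))" for m
    define N where "N m = (\<Sum>a<n. \<Sum>b<n. cnj (P $$ (a, j))
        * ((U (r m) $$ (a, b) - U0 $$ (a, b)) / complex_of_real (e (r m))) * Q (r m) $$ (b, j))" for m
    have q1: "q \<longlonglongrightarrow> 1"
      using inner[OF j j] uP j unfolding unitary_mat_index[OF P] q_def by simp
    have "(\<Sum>a<n. \<Sum>b<n. cnj (P $$ (a, j)) * D $$ (a, b) * P $$ (b, j)) = (mat_adjoint P * D * P) $$ (j, j)"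
    proof -
      note a = mat_adjoint_carrier[OF P]
      have "(mat_adjoint P * D * P) $$ (j, j) = (\<Sum>b<n. (\<Sum>a<n. cnj (P $$ (a, j)) * D $$ (a, b)) * P $$ (b, j))"
        using j by (simp add: index_mult_mat_sum[OF mult_carrier_mat[OF a D] P] index_mult_mat_sum[OF a D]
            mat_adjoint_index[OF P] del: index_mult_mat)
      then show ?thesis unfolding sum_distrib_right by (subst sum.swap) simp
    qed
    moreover have "N \<longlonglongrightarrow> (\<Sum>a<n. \<Sum>b<n. cnj (P $$ (a, j)) * D $$ (a, b) * P $$ (b, j))"
      unfolding N_def using j by (intro tendsto_sum tendsto_mult tendsto_const quot_r Plim) auto
    ultimately have "(\<lambda>m. N m / q m) \<longlonglongrightarrow> (mat_adjoint P * D * P) $$ (j, j)"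
      using tendsto_divide[OF _ q1] by fastforce
    \<comment> \<open>The pairing may vanish for early \<open>m\<close>, so the identity is only
      claimed eventually.\<close>
    moreover have "\<forall>\<^sub>F m in sequentially. q m \<noteq> 0"
      using tendsto_imp_eventually_ne[OF q1] by simp
    then have "\<forall>\<^sub>F m in sequentially. N m / q m = (d0 (r m) j - d j) / complex_of_real (e (r m))"
    proof eventually_elim
      case (elim m)
      have "(d0 (r m) j - d j) * q m = N m * complex_of_real (e (r m))"
        unfolding q_def eigenvalue_difference[OF P uP Q(1,2) j] N_def
        using e(1)[of "r m"] by (simp add: U0_eq Ud sum_distrib_right)
      then show ?case using elim e(1)[of "r m"] by (simp add: field_simps)
    qed
    ultimately show ?thesis by (rule Lim_transform_eventually)
  qed
  moreover have "eigenvalue_mset (U (r m)) = image_mset (d0 (r m)) (mset_set {..<n})" for m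
    unfolding Ud by (rule eigenvalue_mset_spectral_mat[OF Q(1,2)])
  ultimately show thesis
    using that[OF r P uP U0_eq, of "\<lambda>m. d0 (r m)"] d0 by blast
qed

text \<open>Depends on \<open>U\<close> only through its eigenvalue multiset, hence any spectral
  representation may be used to compute it.\<close>

definition arg_ksum :: "nat \<Rightarrow> complex mat \<Rightarrow> real" where
  "arg_ksum k U = ksum k (image_mset (\<lambda>z. \<bar>Arg z\<bar>) (eigenvalue_mset U))"

text \<open>A set that is optimal for one function competes for the other, so the maxima differ by
  no more than the sums over a common set do.\<close>

lemma ksum_diff_le:
  fixes f g :: "nat \<Rightarrow> real"
  assumes "k \<le> n" and *: "\<And>S. S \<subseteq> {..<n} \<Longrightarrow> card S = k \<Longrightarrow> \<bar>sum f S - sum g S\<bar> \<le> c"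
  shows "\<bar>ksum k (image_mset f (mset_set {..<n})) - ksum k (image_mset g (mset_set {..<n}))\<bar> \<le> c"
proof -
  obtain S where S: "S \<subseteq> {..<n}" "card S = k" "ksum k (image_mset f (mset_set {..<n})) = sum f S"
    using ksum_attained[OF \<open>k \<le> n\<close>, of f] by metis
  obtain T where T: "T \<subseteq> {..<n}" "card T = k" "ksum k (image_mset g (mset_set {..<n})) = sum g T"
    using ksum_attained[OF \<open>k \<le> n\<close>, of g] by metis
  show ?thesis
    using sum_le_ksum[OF S(1), of g] sum_le_ksum[OF T(1), of f] *[OF S(1,2)] *[OF T(1,2)] S T by auto
qed

text \<open>The premise \<open>bound\<close> ranges over all spectral representations of
  \<open>U0\<close> because the one selected by the sequence is not known beforehand. A single index
  \<open>m\<close> suffices for the argument by contradiction that follows.\<close>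

lemma arg_ksum_sequence_bound:
  fixes U :: "nat \<Rightarrow> complex mat" and e :: "nat \<Rightarrow> real"
  assumes U: "\<And>m. U m \<in> carrier_mat n n" "\<And>m. unitary_mat (U m)"
    and U0: "U0 \<in> carrier_mat n n" "unitary_mat U0" and D: "D \<in> carrier_mat n n"
    and e: "\<And>m. e m \<noteq> 0" "e \<longlonglongrightarrow> 0"
    and quot: "\<And>i j. i < n \<Longrightarrow> j < n \<Longrightarrow>
      (\<lambda>m. (U m $$ (i, j) - U0 $$ (i, j)) / complex_of_real (e m)) \<longlonglongrightarrow> D $$ (i, j)"
    and bound: "\<And>P d S. P \<in> carrier_mat n n \<Longrightarrow> unitary_mat P \<Longrightarrow> U0 = spectral_mat n P d \<Longrightarrow>
      S \<subseteq> {..<n} \<Longrightarrow> card S = k \<Longrightarrow> (\<Sum>j\<in>S. cmod ((mat_adjoint P * D * P) $$ (j, j))) \<le> c"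
    and "k \<le> n" and "0 < \<eta>"
  shows "\<exists>m. \<bar>arg_ksum k (U m) - arg_ksum k U0\<bar> \<le> \<bar>e m\<bar> * (c + \<eta>)"
proof -
  obtain r :: "nat \<Rightarrow> nat" and P d d' where r: "strict_mono r"
    and P: "P \<in> carrier_mat n n" "unitary_mat P" "U0 = spectral_mat n P d"
    and d': "\<And>m j. j < n \<Longrightarrow> cmod (d' m j) = 1"
    and ev: "\<And>m. eigenvalue_mset (U (r m)) = image_mset (d' m) (mset_set {..<n})"
    and lim: "\<And>j. j < n \<Longrightarrow> (\<lambda>m. (d' m j - d j) / complex_of_real (e (r m)))
      \<longlonglongrightarrow> (mat_adjoint P * D * P) $$ (j, j)"
    using eigenvalue_sequence_derivative[OF U U0(1) D e quot] by blast
  define \<kappa> where "\<kappa> j = cmod ((mat_adjoint P * D * P) $$ (j, j))" for j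
  \<comment> \<open>Distributes the error \<open>\<eta>\<close> over the \<open>k\<close> summands;
    \<open>Suc k\<close> keeps the denominator positive for \<open>k = 0\<close>.\<close>
  define \<theta> where "\<theta> = \<eta> / real (Suc k)"
  have \<theta>: "0 < \<theta>" "real k * \<theta> \<le> \<eta>" using \<open>0 < \<eta>\<close> by (auto simp: \<theta>_def field_simps)
  have er: "(\<lambda>m. e (r m)) \<longlonglongrightarrow> 0"
    using LIMSEQ_subseq_LIMSEQ[OF e(2) r] by (simp add: comp_def)
  have "\<forall>\<^sub>F m in sequentially. \<bar>\<bar>Arg (d' m j)\<bar> - \<bar>Arg (d j)\<bar>\<bar> \<le> \<bar>e (r m)\<bar> * (\<kappa> j + \<theta>)" if j: "j < n" for j
    unfolding \<kappa>_def
  proof (rule abs_Arg_sequence_bound[OF d'[OF j] _ e(1) er lim[OF j] \<theta>(1)])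
    show "cmod (d j) = 1" using unitary_spectrum[OF P(1,2) _ j] U0(2) P(3) by simp
  qed
  then have "\<forall>\<^sub>F m in sequentially. \<forall>j\<in>{..<n}. \<bar>\<bar>Arg (d' m j)\<bar> - \<bar>Arg (d j)\<bar>\<bar> \<le> \<bar>e (r m)\<bar> * (\<kappa> j + \<theta>)"
    by (intro eventually_ball_finite) auto
  then obtain m where m: "\<And>j. j < n \<Longrightarrow> \<bar>\<bar>Arg (d' m j)\<bar> - \<bar>Arg (d j)\<bar>\<bar> \<le> \<bar>e (r m)\<bar> * (\<kappa> j + \<theta>)"
    unfolding eventually_sequentially by auto
  have "\<bar>(\<Sum>j\<in>S. \<bar>Arg (d' m j)\<bar>) - (\<Sum>j\<in>S. \<bar>Arg (d j)\<bar>)\<bar> \<le> \<bar>e (r m)\<bar> * (c + \<eta>)"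
    if S: "S \<subseteq> {..<n}" "card S = k" for S
  proof -
    have "\<bar>(\<Sum>j\<in>S. \<bar>Arg (d' m j)\<bar>) - (\<Sum>j\<in>S. \<bar>Arg (d j)\<bar>)\<bar>
        \<le> (\<Sum>j\<in>S. \<bar>\<bar>Arg (d' m j)\<bar> - \<bar>Arg (d j)\<bar>\<bar>)"
      unfolding sum_subtractf[symmetric] by (rule sum_abs)
    also have "\<dots> \<le> (\<Sum>j\<in>S. \<bar>e (r m)\<bar> * (\<kappa> j + \<theta>))" using S by (intro sum_mono m) auto
    also have "\<dots> = \<bar>e (r m)\<bar> * ((\<Sum>j\<in>S. \<kappa> j) + real k * \<theta>)"
      using S by (simp add: sum_distrib_left[symmetric] sum.distrib)
    also have "\<dots> \<le> \<bar>e (r m)\<bar> * (c + \<eta>)"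
      using bound[OF P S] \<theta>(2) unfolding \<kappa>_def by (intro mult_left_mono add_mono) auto
    finally show ?thesis .
  qed
  then have "\<bar>ksum k (image_mset (\<lambda>j. \<bar>Arg (d' m j)\<bar>) (mset_set {..<n}))
      - ksum k (image_mset (\<lambda>j. \<bar>Arg (d j)\<bar>) (mset_set {..<n}))\<bar> \<le> \<bar>e (r m)\<bar> * (c + \<eta>)"
    by (rule ksum_diff_le[OF \<open>k \<le> n\<close>])
  then have "\<bar>arg_ksum k (U (r m)) - arg_ksum k U0\<bar> \<le> \<bar>e (r m)\<bar> * (c + \<eta>)"
    by (simp add: arg_ksum_def ev P(3) eigenvalue_mset_spectral_mat[OF P(1,2)]
        image_mset.compositionality comp_def)
  then show ?thesis ..
qed

text \<open>A mean value inequality without derivatives of the eigenvalues: a local Lipschitz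
  estimate at each \<open>t\<close> with constant \<open>c + \<eta>\<close> is glued along the unit
  interval, and \<open>\<eta>\<close> is arbitrary.\<close>

lemma arg_ksum_curve_bound:
  fixes V :: "real \<Rightarrow> complex mat"
  assumes V: "\<And>t. V t \<in> carrier_mat n n" "\<And>t. unitary_mat (V t)"
    and D: "\<And>t. D t \<in> carrier_mat n n"
    and deriv: "\<And>t i j. i < n \<Longrightarrow> j < n \<Longrightarrow>
      ((\<lambda>s. (V s $$ (i, j) - V t $$ (i, j)) / complex_of_real (s - t)) \<longlongrightarrow> D t $$ (i, j)) (at t)"
    and bound: "\<And>t P d S. P \<in> carrier_mat n n \<Longrightarrow> unitary_mat P \<Longrightarrow> V t = spectral_mat n P d \<Longrightarrow>
      S \<subseteq> {..<n} \<Longrightarrow> card S = k \<Longrightarrow> (\<Sum>j\<in>S. cmod ((mat_adjoint P * D t * P) $$ (j, j))) \<le> c"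
    and "k \<le> n"
  shows "arg_ksum k (V 1) \<le> arg_ksum k (V 0) + c"
proof (rule field_le_epsilon)
  fix \<eta> :: real assume "0 < \<eta>"
  define F where "F t = arg_ksum k (V t)" for t
  have local: "\<exists>\<delta>>0. \<forall>s. \<bar>s - t\<bar> < \<delta> \<longrightarrow> \<bar>F s - F t\<bar> \<le> \<bar>s - t\<bar> * (c + \<eta>)" for t
  proof (rule ccontr)
    assume neg: "\<not> ?thesis"
    \<comment> \<open>If no radius works, each radius \<open>1 / real (Suc m)\<close> supplies a
      violating point; these points form a sequence tending to \<open>t\<close> that contradicts
      \<open>arg_ksum_sequence_bound\<close>. None equals \<open>t\<close>, where the estimate is
      trivial.\<close>
    have "\<exists>s. \<bar>s - t\<bar> < 1 / real (Suc m) \<and> \<not> \<bar>F s - F t\<bar> \<le> \<bar>s - t\<bar> * (c + \<eta>)" for m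
      using neg by (auto dest: spec[of _ "1 / real (Suc m)"])
    then obtain s where s: "\<And>m. \<bar>s m - t\<bar> < 1 / real (Suc m)"
      and viol: "\<And>m. \<not> \<bar>F (s m) - F t\<bar> \<le> \<bar>s m - t\<bar> * (c + \<eta>)" by metis
    have ne: "s m - t \<noteq> 0" for m using viol[of m] by auto
    have "(\<lambda>m. \<bar>s m - t\<bar>) \<longlonglongrightarrow> 0"
      by (rule tendsto_sandwich[OF _ _ tendsto_const LIMSEQ_inverse_real_of_nat])
        (use s in \<open>auto simp: inverse_eq_divide intro!: always_eventually less_imp_le\<close>)
    then have s0: "(\<lambda>m. s m - t) \<longlonglongrightarrow> 0" by (rule tendsto_rabs_zero_cancel)
    then have "filterlim s (at t) sequentially"
      using ne by (auto simp: filterlim_at LIM_zero_iff)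
    then have "\<exists>m. \<bar>arg_ksum k (V (s m)) - arg_ksum k (V t)\<bar> \<le> \<bar>s m - t\<bar> * (c + \<eta>)"
      using filterlim_compose[OF deriv]
      by (intro arg_ksum_sequence_bound[OF V V(1,2) D ne s0 _ bound \<open>k \<le> n\<close> \<open>0 < \<eta>\<close>]) auto
    then show False using viol by (auto simp: F_def)
  qed
  \<comment> \<open>Bisection principle: the estimate is additive over adjacent intervals and holds
    on every short interval containing a given point, hence on the whole unit interval.\<close>
  have "\<bar>F 1 - F 0\<bar> \<le> (1 - 0) * (c + \<eta>)"
  proof (rule Bolzano[of 0 1 "\<lambda>x y. \<bar>F y - F x\<bar> \<le> (y - x) * (c + \<eta>)"])
    fix x y z :: real
    assume "\<bar>F y - F x\<bar> \<le> (y - x) * (c + \<eta>)" "\<bar>F z - F y\<bar> \<le> (z - y) * (c + \<eta>)"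
    moreover have "(z - x) * (c + \<eta>) = (y - x) * (c + \<eta>) + (z - y) * (c + \<eta>)"
      by (simp add: algebra_simps)
    ultimately show "\<bar>F z - F x\<bar> \<le> (z - x) * (c + \<eta>)" by linarith
  next
    fix x :: real
    obtain \<delta> where \<delta>: "0 < \<delta>" "\<And>s. \<bar>s - x\<bar> < \<delta> \<Longrightarrow> \<bar>F s - F x\<bar> \<le> \<bar>s - x\<bar> * (c + \<eta>)"
      using local[of x] by blast
    have "\<bar>F b - F a\<bar> \<le> (b - a) * (c + \<eta>)" if "a \<le> x" "x \<le> b" "b - a < \<delta>" for a b
    proof -
      have "\<bar>F a - F x\<bar> \<le> (x - a) * (c + \<eta>)" "\<bar>F b - F x\<bar> \<le> (b - x) * (c + \<eta>)"
        using \<delta>(2)[of a] \<delta>(2)[of b] that by auto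
      moreover have "(b - a) * (c + \<eta>) = (x - a) * (c + \<eta>) + (b - x) * (c + \<eta>)"
        by (simp add: algebra_simps)
      ultimately show ?thesis by linarith
    qed
    then show "\<exists>d>0. \<forall>a b. a \<le> x \<and> x \<le> b \<and> b - a < d \<longrightarrow> \<bar>F b - F a\<bar> \<le> (b - a) * (c + \<eta>)"
      using \<delta>(1) by blast
  qed simp
  then show "arg_ksum k (V 1) \<le> arg_ksum k (V 0) + c + \<eta>" by (simp add: F_def)
qed

section \<open>Products of exponential curves\<close>

text \<open>Restricts a complex derivative to approach along the real axis.\<close>

lemma tendsto_real_difference_quotient:
  fixes g :: "complex \<Rightarrow> complex"
  assumes "(g has_field_derivative D) (at (complex_of_real t))"
  shows "((\<lambda>s. (g (complex_of_real s) - g (complex_of_real t)) / complex_of_real (s - t)) \<longlongrightarrow> D) (at t)"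
proof -
  have lim: "((\<lambda>z. (g z - g (complex_of_real t)) / (z - complex_of_real t)) \<longlongrightarrow> D) (at (complex_of_real t))"
    using assms by (simp add: has_field_derivative_iff)
  have "filterlim complex_of_real (at (complex_of_real t)) (at t)"
    by (auto simp: filterlim_at eventually_at_filter intro!: tendsto_intros)
  from filterlim_compose[OF lim this] show ?thesis by simp
qed

text \<open>The one-parameter group of \<open>exp (\<i>tA)\<close>, where \<open>A\<close> has
  eigenbasis \<open>P\<close> and real eigenvalues \<open>a\<close>, given by functional
  calculus.\<close>

definition exp_curve :: "nat \<Rightarrow> complex mat \<Rightarrow> (nat \<Rightarrow> real) \<Rightarrow> real \<Rightarrow> complex mat" where
  "exp_curve n P a t = spectral_mat n P (\<lambda>j. cis (t * a j))"

abbreviation generator :: "nat \<Rightarrow> complex mat \<Rightarrow> (nat \<Rightarrow> real) \<Rightarrow> complex mat" where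
  "generator n P a \<equiv> spectral_mat n P (\<lambda>j. \<i> * complex_of_real (a j))"

lemma exp_curve_carrier: "P \<in> carrier_mat n n \<Longrightarrow> exp_curve n P a t \<in> carrier_mat n n"
  by (simp add: exp_curve_def spectral_mat_carrier)

lemma exp_curve_unitary:
  "P \<in> carrier_mat n n \<Longrightarrow> unitary_mat P \<Longrightarrow> unitary_mat (exp_curve n P a t)"
  unfolding exp_curve_def by (rule spectral_mat_unitary) auto

lemma exp_curve_generator:
  assumes "P \<in> carrier_mat n n" "unitary_mat P"
  shows "exp_curve n P a t * generator n P a = generator n P a * exp_curve n P a t"
  by (simp add: exp_curve_def spectral_mat_mult[OF assms] mult_ac)

text \<open>The entries of both curves extend to entire functions of \<open>t\<close>, so that the derivative rules
  for complex fields apply.\<close>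

lemma exp_curve_product_derivative:
  fixes a b :: "nat \<Rightarrow> real"
  assumes P: "P \<in> carrier_mat n n" "unitary_mat P" and Q: "Q \<in> carrier_mat n n" "unitary_mat Q"
    and ij: "i < n" "j < n"
  defines "V \<equiv> \<lambda>t. exp_curve n P a t * exp_curve n Q b t"
  shows "((\<lambda>s. (V s $$ (i, j) - V t $$ (i, j)) / complex_of_real (s - t)) \<longlongrightarrow>
    (exp_curve n P a t * (generator n P a + generator n Q b) * exp_curve n Q b t) $$ (i, j)) (at t)"
proof -
  \<comment> \<open>The entry of the exponential curve as an entire function of the time parameter
    \<open>z\<close>.\<close>
  define G where "G M c i j z = (\<Sum>l<n. M $$ (i, l) * exp (\<i> * z * complex_of_real (c l)) * cnj (M $$ (j, l)))"
    for M :: "complex mat" and c :: "nat \<Rightarrow> real" and i j :: nat and z :: complex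
  have G_real: "exp_curve n M c s $$ (i', j') = G M c i' j' (complex_of_real s)"
    if "M \<in> carrier_mat n n" "i' < n" "j' < n" for M c s i' j'
    by (simp add: exp_curve_def index_spectral_mat[OF that] G_def cis_conv_exp mult_ac)
  have G_deriv: "(G M c i' j' has_field_derivative
      (exp_curve n M c s * generator n M c) $$ (i', j')) (at (complex_of_real s))"
    if "M \<in> carrier_mat n n" "unitary_mat M" "i' < n" "j' < n" for M c s i' j'
  proof -
    have "(G M c i' j' has_field_derivative
        (\<Sum>l<n. M $$ (i', l) * (exp (\<i> * z * complex_of_real (c l)) * (\<i> * complex_of_real (c l))) * cnj (M $$ (j', l)))) (at z)" for z
      unfolding G_def by (auto intro!: derivative_eq_intros sum.cong simp: mult_ac)
    from this[of "complex_of_real s"] show ?thesis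
      by (simp add: exp_curve_def spectral_mat_mult[OF that(1,2)] index_spectral_mat[OF that(1,3,4)]
          cis_conv_exp mult_ac)
  qed
  let ?EA = "exp_curve n P a t" and ?EB = "exp_curve n Q b t"
  note carr = exp_curve_carrier[OF P(1), of a t] exp_curve_carrier[OF Q(1), of b t]
    spectral_mat_carrier[OF P(1), of "\<lambda>j. \<i> * complex_of_real (a j)"]
    spectral_mat_carrier[OF Q(1), of "\<lambda>j. \<i> * complex_of_real (b j)"]
  define H where "H z = (\<Sum>k<n. G P a i k z * G Q b k j z)" for z
  have V: "V s $$ (i, j) = H (complex_of_real s)" for s
    unfolding V_def H_def
    using ij P Q by (simp add: index_mult_mat_sum[OF exp_curve_carrier exp_curve_carrier] G_real del: index_mult_mat)
  have "(H has_field_derivative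
      (\<Sum>k<n. (?EA * generator n P a) $$ (i, k) * G Q b k j (complex_of_real t)
        + (?EB * generator n Q b) $$ (k, j) * G P a i k (complex_of_real t))) (at (complex_of_real t))"
    unfolding H_def using ij by (intro DERIV_sum DERIV_mult G_deriv P Q) auto
  also have "(\<Sum>k<n. (?EA * generator n P a) $$ (i, k) * G Q b k j (complex_of_real t)
        + (?EB * generator n Q b) $$ (k, j) * G P a i k (complex_of_real t))
      = ((?EA * generator n P a) * ?EB + ?EA * (?EB * generator n Q b)) $$ (i, j)"
  proof -
    define MA MB where "MA = ?EA * generator n P a" and "MB = ?EB * generator n Q b"
    have M: "MA \<in> carrier_mat n n" "MB \<in> carrier_mat n n" using carr by (auto simp: MA_def MB_def)
    have "(MA * ?EB + ?EA * MB) $$ (i, j) = (\<Sum>k<n. MA $$ (i, k) * ?EB $$ (k, j)) + (\<Sum>k<n. ?EA $$ (i, k) * MB $$ (k, j))"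
      using ij M carr
      by (simp add: index_mult_mat_sum[OF M(1) carr(2)] index_mult_mat_sum[OF carr(1) M(2)] del: index_mult_mat(1))
    then show ?thesis
      unfolding MA_def[symmetric] MB_def[symmetric]
      using ij P Q by (simp add: G_real sum.distrib mult.commute)
  qed
  \<comment> \<open>The second generator commutes with its own curve, so both generators can be
    collected between the two exponentials.\<close>
  also have "(?EA * generator n P a) * ?EB + ?EA * (?EB * generator n Q b)
      = ?EA * (generator n P a + generator n Q b) * ?EB"
    unfolding exp_curve_generator[OF Q]
    using carr by (simp add: mult_add_distrib_mat[of _ n n _ n] add_mult_distrib_mat[of _ n n _ _ n]
        assoc_mult_mat[of _ n n _ n _ n] mult_carrier_mat[of _ n n _ n])
  finally show ?thesis unfolding V by (rule tendsto_real_difference_quotient)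
qed

text \<open>In an eigenbasis \<open>T\<close> of the curve at time \<open>t\<close>, the velocity
  has the same diagonal moduli as a unitary conjugate of the sum of the generators; Ky Fan's
  principle bounds these uniformly in \<open>t\<close>.\<close>

lemma arg_ksum_exp_product_le:
  assumes P: "P \<in> carrier_mat n n" "unitary_mat P" and Q: "Q \<in> carrier_mat n n" "unitary_mat Q"
    and R: "R \<in> carrier_mat n n" "unitary_mat R"
    and sum: "generator n P a + generator n Q b = spectral_mat n R g"
    and "k \<le> n"
  shows "arg_ksum k (exp_curve n P a 1 * exp_curve n Q b 1)
    \<le> ksum k (image_mset (\<lambda>l. cmod (g l)) (mset_set {..<n}))"
proof -
  define V where "V t = exp_curve n P a t * exp_curve n Q b t" for t
  note cA = exp_curve_carrier[OF P(1), of a] and cB = exp_curve_carrier[OF Q(1), of b]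
  note uA = exp_curve_unitary[OF P, of a] and uB = exp_curve_unitary[OF Q, of b]
  note cG = spectral_mat_carrier[OF R(1), of g]
  let ?D = "\<lambda>t. exp_curve n P a t * spectral_mat n R g * exp_curve n Q b t"
  have "arg_ksum k (V 1) \<le> arg_ksum k (V 0) + ksum k (image_mset (\<lambda>l. cmod (g l)) (mset_set {..<n}))"
  proof (rule arg_ksum_curve_bound[where D = ?D])
    show "V t \<in> carrier_mat n n" for t unfolding V_def by (rule mult_carrier_mat[OF cA cB])
    show "unitary_mat (V t)" for t unfolding V_def by (rule unitary_mat_mult[OF uA cA uB cB])
    show "?D t \<in> carrier_mat n n" for t by (rule mult_carrier_mat[OF mult_carrier_mat[OF cA cG] cB])
    show "((\<lambda>s. (V s $$ (i, j) - V t $$ (i, j)) / complex_of_real (s - t)) \<longlongrightarrow> ?D t $$ (i, j)) (at t)"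
      if "i < n" "j < n" for t i j
      using exp_curve_product_derivative[OF P Q that, of a b t] unfolding V_def sum .
    show "k \<le> n" by fact
    fix t T d S assume T: "T \<in> carrier_mat n n" "unitary_mat T" and Vt: "V t = spectral_mat n T d"
      and S: "S \<subseteq> {..<n}" "card S = k"
    let ?EA = "exp_curve n P a t" and ?EB = "exp_curve n Q b t"
    \<comment> \<open>Chosen so that \<open>?EA * W = T\<close>; the eigenvector equation for
      \<open>V t\<close> then turns \<open>?EB * T\<close> into \<open>W\<close> times the diagonal
      of eigenvalues, whose unimodular entries do not affect moduli.\<close>
    define W where "W = mat_adjoint ?EA * T"
    note aA = mat_adjoint_carrier[OF cA[of t]] and aT = mat_adjoint_carrier[OF T(1)]
    have W: "W \<in> carrier_mat n n" "unitary_mat W"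
      unfolding W_def using aA T unitary_mat_mult[OF unitary_mat_adjoint[OF uA cA] aA T(2,1)] by auto
    have aW: "mat_adjoint W = mat_adjoint T * ?EA"
      unfolding W_def mat_adjoint_mult[OF aA T(1)] mat_adjoint_adjoint[OF cA] ..
    have "?EB * T = mat_adjoint ?EA * (V t * T)"
      unfolding V_def assoc_mult_mat[OF cA cB T(1)]
      by (rule unitary_cancel(2)[OF uA cA mult_carrier_mat[OF cB T(1)], symmetric])
    also have "\<dots> = W * mat_diag n d"
      unfolding Vt spectral_mat_mult_vecs(1)[OF T] W_def using aA T
      by (simp add: assoc_mult_mat[of _ n n _ n _ n])
    finally have EB: "?EB * T = W * mat_diag n d" .
    have "mat_adjoint T * ?D t * T = mat_adjoint W * spectral_mat n R g * (?EB * T)"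
      unfolding aW using cA cB cG T aT
      by (simp add: assoc_mult_mat[of _ n n _ n _ n] mult_carrier_mat[of _ n n _ n])
    also have "\<dots> = mat_adjoint W * spectral_mat n R g * W * mat_diag n d"
      unfolding EB using W mat_adjoint_carrier[OF W(1)] cG
      by (simp add: assoc_mult_mat[of _ n n _ n _ n] mult_carrier_mat[of _ n n _ n])
    finally have D_eq: "mat_adjoint T * ?D t * T = mat_adjoint W * spectral_mat n R g * W * mat_diag n d" .
    have M: "mat_adjoint W * spectral_mat n R g * W \<in> carrier_mat n n"
      using W mat_adjoint_carrier[OF W(1)] cG by auto
    have "cmod ((mat_adjoint T * ?D t * T) $$ (j, j)) = cmod ((mat_adjoint W * spectral_mat n R g * W) $$ (j, j))"
      if "j \<in> S" for j
    proof -
      have j: "j < n" using that S by auto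
      have "cmod (d j) = 1"
        using unitary_spectrum[OF T _ j] unitary_mat_mult[OF uA cA uB cB] Vt unfolding V_def by metis
      then show ?thesis
        unfolding D_eq using j by (simp add: mat_diag_mult_right[OF M] norm_mult del: index_mult_mat)
    qed
    then have "(\<Sum>j\<in>S. cmod ((mat_adjoint T * ?D t * T) $$ (j, j)))
        = (\<Sum>j\<in>S. cmod ((mat_adjoint W * spectral_mat n R g * W) $$ (j, j)))"
      by (rule sum.cong[OF refl])
    also have "\<dots> \<le> ksum k (image_mset (\<lambda>l. cmod (g l)) (mset_set {..<n}))"
      using sum_diag_le_ksum[OF R W S(1), of g] unfolding S(2) .
    finally show "(\<Sum>j\<in>S. cmod ((mat_adjoint T * ?D t * T) $$ (j, j)))
        \<le> ksum k (image_mset (\<lambda>l. cmod (g l)) (mset_set {..<n}))" .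
  qed
  \<comment> \<open>The curve starts at the identity, all of whose arguments are zero.\<close>
  moreover have "arg_ksum k (V 0) = 0"
  proof -
    have "V 0 = spectral_mat n P (\<lambda>j. 1)"
      unfolding V_def exp_curve_def by (simp add: spectral_mat_one[OF P] spectral_mat_one[OF Q])
    then have "arg_ksum k (V 0) = ksum k (image_mset (\<lambda>j. 0) (mset_set {..<n}))"
      by (simp add: arg_ksum_def eigenvalue_mset_spectral_mat[OF P] image_mset.compositionality comp_def
          cis_Arg_unique[of 1 0, simplified])
    also have "\<dots> = 0"
      by (rule ksum_attained[OF \<open>k \<le> n\<close>, of "\<lambda>j. 0"]) simp
    finally show ?thesis .
  qed
  ultimately show ?thesis unfolding V_def by simp
qed

section \<open>Hermitian logarithms and weak submajorization\<close>

lemma hermitian_spectral_mat: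
  assumes P: "P \<in> carrier_mat n n"
  shows "hermitian_mat (spectral_mat n P (\<lambda>j. complex_of_real (a j)))"
  using spectral_mat_carrier[OF P, of "\<lambda>j. complex_of_real (a j)"]
  by (simp add: hermitian_mat_def mat_adjoint_spectral_mat[OF P])

lemma hermitian_mat_spectral:
  assumes "hermitian_mat A" "A \<in> carrier_mat n n"
  obtains P d where "P \<in> carrier_mat n n" "unitary_mat P" "A = spectral_mat n P d"
  using normal_mat_diagonalizable[OF _ assms(2)] assms(1) by (auto simp: normal_mat_def hermitian_mat_def)

lemma smult_spectral_mat:
  assumes P: "P \<in> carrier_mat n n"
  shows "c \<cdot>\<^sub>m spectral_mat n P d = spectral_mat n P (\<lambda>j. c * d j)"
  using spectral_mat_carrier[OF P, of d] spectral_mat_carrier[OF P, of "\<lambda>j. c * d j"]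
  by (intro eq_matI) (auto simp: index_spectral_mat[OF P] sum_distrib_left mult_ac)

text \<open>\<open>A\<close> and \<open>B\<close> are the logarithms of \<open>X\<close> and
  \<open>Y\<close> with the principal arguments as eigenvalues; the moduli of these are at once
  singular values and absolute arguments.\<close>

theorem abs_args_weakly_submajorized:
  assumes X: "unitary_mat X" "X \<in> carrier_mat n n" and Y: "unitary_mat Y" "Y \<in> carrier_mat n n"
  obtains A B where "A \<in> carrier_mat n n" "B \<in> carrier_mat n n" "hermitian_mat A" "hermitian_mat B"
    "singular_values_desc A = abs_args_desc X" "singular_values_desc B = abs_args_desc Y"
    "weakly_submajorized (abs_args_desc (X * Y)) (singular_values_desc (A + B))"
proof -
  have log: "\<exists>P a. P \<in> carrier_mat n n \<and> unitary_mat P \<and> Z = exp_curve n P a 1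
      \<and> singular_values_desc (spectral_mat n P (\<lambda>j. complex_of_real (a j))) = abs_args_desc Z"
    if Z: "unitary_mat Z" "Z \<in> carrier_mat n n" for Z
  proof -
    obtain P d where P: "P \<in> carrier_mat n n" "unitary_mat P" "Z = spectral_mat n P d"
      and d: "\<And>j. j < n \<Longrightarrow> cmod (d j) = 1"
      using unitary_mat_spectral[OF Z] by metis
    have "cis (Arg (d j)) = d j" if "j < n" for j
      using rcis_cmod_Arg[of "d j"] d[OF that] by (simp add: rcis_def)
    then have "Z = exp_curve n P (\<lambda>j. Arg (d j)) 1"
      unfolding exp_curve_def P(3) by (intro spectral_mat_cong) auto
    moreover have "singular_values_desc (spectral_mat n P (\<lambda>j. complex_of_real (Arg (d j)))) = abs_args_desc Z"
      by (simp add: singular_values_desc_spectral_mat[OF P(1,2)] P(3) abs_args_desc_spectral_mat[OF P(1,2)])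
    ultimately show ?thesis using P by blast
  qed
  obtain P a where P: "P \<in> carrier_mat n n" "unitary_mat P" and Xe: "X = exp_curve n P a 1"
    and svA: "singular_values_desc (spectral_mat n P (\<lambda>j. complex_of_real (a j))) = abs_args_desc X"
    using log[OF X] by blast
  obtain Q b where Q: "Q \<in> carrier_mat n n" "unitary_mat Q" and Ye: "Y = exp_curve n Q b 1"
    and svB: "singular_values_desc (spectral_mat n Q (\<lambda>j. complex_of_real (b j))) = abs_args_desc Y"
    using log[OF Y] by blast
  define A where "A = spectral_mat n P (\<lambda>j. complex_of_real (a j))"
  define B where "B = spectral_mat n Q (\<lambda>j. complex_of_real (b j))"
  have A: "A \<in> carrier_mat n n" "hermitian_mat A"
    unfolding A_def by (rule spectral_mat_carrier[OF P(1)], rule hermitian_spectral_mat[OF P(1)])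
  have B: "B \<in> carrier_mat n n" "hermitian_mat B"
    unfolding B_def by (rule spectral_mat_carrier[OF Q(1)], rule hermitian_spectral_mat[OF Q(1)])
  have AB: "A + B \<in> carrier_mat n n" using A B by simp
  have "hermitian_mat (A + B)"
    using A B mat_adjoint_add[OF A(1) B(1)] by (auto simp: hermitian_mat_def)
  then obtain R d where R: "R \<in> carrier_mat n n" "unitary_mat R" and Rd: "A + B = spectral_mat n R d"
    using hermitian_mat_spectral[OF _ AB] by blast
  \<comment> \<open>The factor \<open>\<i>\<close> has modulus 1, so the spectral values of the
    generator sum have as moduli the singular values of \<open>A + B\<close>.\<close>
  have "generator n P a + generator n Q b = \<i> \<cdot>\<^sub>m (A + B)"
    using add_smult_distrib_left_mat[OF A(1) B(1), of \<i>]
    by (simp add: A_def B_def smult_spectral_mat[OF P(1)] smult_spectral_mat[OF Q(1)])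
  then have gen: "generator n P a + generator n Q b = spectral_mat n R (\<lambda>j. \<i> * d j)"
    by (simp add: Rd smult_spectral_mat[OF R(1)])
  have XY: "X * Y \<in> carrier_mat n n" using X Y by simp
  have "(\<Sum>j<k. abs_args_desc (X * Y) ! j) \<le> (\<Sum>j<k. singular_values_desc (A + B) ! j)" if "k \<le> n" for k
    using arg_ksum_exp_product_le[OF P Q R gen that]
    by (simp add: Xe Ye arg_ksum_def ksum_def abs_args_desc_def Rd singular_values_desc_spectral_mat[OF R] norm_mult)
  then have "weakly_submajorized (abs_args_desc (X * Y)) (singular_values_desc (A + B))"
    using abs_args_desc_noninc[OF XY] singular_values_desc_noninc[OF AB]
    by (auto simp: weakly_submajorized_def noninc_seqs_def)
  then show thesis
    using that[of A B] A B svA svB by (simp add: A_def B_def)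
qed

theorem proposition6:
  fixes n :: nat and h :: "real list \<Rightarrow> real list \<Rightarrow> real list \<Rightarrow> real"
  assumes "1 \<le> n"
    and "\<And>A B. A \<in> carrier_mat n n \<Longrightarrow> B \<in> carrier_mat n n \<Longrightarrow>
           hermitian_mat A \<Longrightarrow> hermitian_mat B \<Longrightarrow>
           h (singular_values_desc (A + B)) (singular_values_desc A) (singular_values_desc B) \<le> 0"
    and "\<And>v w. v \<in> noninc_seqs n \<Longrightarrow> w \<in> noninc_seqs n \<Longrightarrow> schur_convex n (\<lambda>u. h u v w)"
    and "X \<in> carrier_mat n n" and "Y \<in> carrier_mat n n"
    and "unitary_mat X" and "unitary_mat Y"
  shows "h (abs_args_desc (X * Y)) (abs_args_desc X) (abs_args_desc Y) \<le> 0"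
proof -
  obtain A B where A: "A \<in> carrier_mat n n" "hermitian_mat A" and B: "B \<in> carrier_mat n n" "hermitian_mat B"
    and sv: "singular_values_desc A = abs_args_desc X" "singular_values_desc B = abs_args_desc Y"
    and maj: "weakly_submajorized (abs_args_desc (X * Y)) (singular_values_desc (A + B))"
    using abs_args_weakly_submajorized[OF assms(6,4,7,5)] by metis
  have XY: "X * Y \<in> carrier_mat n n" and AB: "A + B \<in> carrier_mat n n" using assms(4,5) A B by auto
  \<comment> \<open>Schur-convexity is applied with the last two arguments frozen at the absolute
    arguments of \<open>X\<close> and \<open>Y\<close>, which are also the singular values of
    \<open>A\<close> and \<open>B\<close>.\<close>
  have "h (abs_args_desc (X * Y)) (abs_args_desc X) (abs_args_desc Y)
      \<le> h (singular_values_desc (A + B)) (abs_args_desc X) (abs_args_desc Y)"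
    using assms(3)[OF abs_args_desc_noninc[OF assms(4)] abs_args_desc_noninc[OF assms(5)]]
      abs_args_desc_noninc[OF XY] singular_values_desc_noninc[OF AB] maj
    by (auto simp: schur_convex_def)
  also have "\<dots> \<le> 0" using assms(2)[OF A(1) B(1) A(2) B(2)] unfolding sv .
  finally show ?thesis .
qed

end
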